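(* Let $X$ be an oriented odd $AB$-graph. Choose a maximal tree $T$ of $X$, an ordering $o_1=(s_1,\dots,s_a)$ of the type A vertices of $X$, and an ordering $o_2=(e_1,\dots,e_k)$ of the edges of $X-T$. Then the chain $\Phi(X)\in\mathbf B_*$ constructed from these data is a cycle, i.e. $d\,\Phi(X)=0$.
   Context: Graphs are finite, with loops and multiple edges allowed; vector spaces are over $\mathbb Q$. **The chain complex $\mathbf B_*$.** A core graph is a graph with all vertices of valence at least $2$ and no separating edges (not necessarily connected). A filtered $r$-graph $\mathbf G$ is a connected graph $G$ with $\operatorname{rank}\pi_1(G)=r$ and all vertices of valence $\ge 3$, with a (possibly empty) chain $G_1\subsetneq\cdots\subsetneq G_{k-1}$ of proper core subgraphs of $G$; put $G_k=G$. An orientation is an ordering of the edges of $G$ up to even permutation. The degree is (number of edges of $G$) $-\,k$. $\mathbf B_*$ is the graded vector space spanned by isomorphism classes (isomorphisms preserve the filtration) of oriented filtered $r$-graphs modulo $(\mathbf G,-or)=-(\mathbf G,or)$. The differential is $d=d_E+d_F$ with $$d_F(\mathbf G)=\sum_C(-1)^{f(C)}\mathbf G\langle C\rangle,\qquad d_E(\mathbf G)=\sum_e(-1)^{n(e)+k-1}\mathbf G_e .$$ Here $C$ runs over all core subgraphs that can be inserted into the filtration, $\mathbf G\langle C\rangle$ is the result (same edge ordering), and $f(C)$ is the position of $C$ in the new filtration; $e$ runs over all edges whose collapse preserves both the rank of $G$ and the number of graphs in the filtration (so $e$ is not a loop and is not all of some $G_i-G_{i-1}$), $\mathbf G_e$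 is the result of collapsing $e$ (omit $e$ from the ordering), and $n(e)$ is the position of $e$ in the ordering. **$AB$-graphs.** An $AB$-graph is a connected graph with all vertices of valence $\ge3$, each vertex being designated type A or type B. It is odd if all type A vertices have odd valence. An orientation of an odd $AB$-graph is an ordering of the half-edges incident to each type A vertex; a reordering changes the orientation by the sign of the permutation. **Construction of $\Phi(X)$.** Given $X$, $T$, $o_1$, $o_2$: to each type A vertex $s$ of valence $v$ associate a $v$-gon $\Delta_s$ with edges ordered cyclically $1,\dots,v$, which gives an ordering $1,\dots,v$ of its vertices. Let $I_s$ be the set of bijections from the half-edges incident to $s$ to the vertices of $\Delta_s$; using the orientation of $X$ (ordering of the half-edges at $s$), $I_s$ is identified with permutations of $v$ letters, and $\epsilon(\iota)$ denotes the sign of $\iota\in I_s$. For $\iota_j\in I_{s_j}$, replace each type A vertex $s_j$ by the polygon $\Delta_{s_j}$, attaching the half-edges at $s_j$ to the vertices of $\Delta_{s_j}$ via $\iota_j$, and then collapse the image of $T$ (each component of it to a point), obtaining a graph $Y=Y[\iota_1,\dots,\iota_a]$. Orient $Y$ by listing the edges of $\Delta_{s_1}$, then those of $\Delta_{s_2}$, ..., $\Delta_{s_a}$ (each in its order), then $e_1,\dots,e_k$. Filter $Y$ by $$\Delta_{s_1}\subset\Delta_{s_1}\cup\Delta_{s_2}\subset\cdots\subset\Delta_{s_1}\cup\cdots\cup\Delta_{s_a}\subset\Delta_{s_1}\cup\cdots\cup\Delta_{s_a}\cup e_1\subset\cdots\subset\Delta_{s_1}\cup\cdots\cup\Delta_{s_a}\cup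 e_1\cup\cdots\cup e_k=Y.$$ Then $\Phi(X)=\sum_{\iota_j\in I_{s_j}}\epsilon(\iota_1)\cdots\epsilon(\iota_a)\,Y[\iota_1,\dots,\iota_a]$, where the sum is over all choices of $\iota_1,\dots,\iota_a$. *)

theory Defs
  imports
    "Graph_Theory.Digraph_Component"
    "HOL-Library.Poly_Mapping"
    "HOL-Library.FuncSet"
    "HOL-Combinatorics.Permutations"
begin

section \<open>Graphs with loops and multiple edges\<close>

text \<open>
  An undirected multigraph is a \<open>pre_digraph\<close> with one arc per edge; the direction of the arc
  carries no information, and isomorphisms (see \<open>graph_iso\<close>) may reverse it. The two
  half-edges of \<open>e\<close> are \<open>(e, False)\<close>, at the tail, and \<open>(e, True)\<close>, at the head, so a loop
  contributes two half-edges at its vertex. Connectivity is that of the underlying undirected graph.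
\<close>

fun end_of :: "('v, 'e) pre_digraph \<Rightarrow> 'e \<times> bool \<Rightarrow> 'v" where
  "end_of G (e, b) = (if b then head G e else tail G e)"

definition half_edges_at :: "('v, 'e) pre_digraph \<Rightarrow> 'v \<Rightarrow> ('e \<times> bool) set" where
  "half_edges_at G v = {x \<in> arcs G \<times> UNIV. end_of G x = v}"

definition valence :: "('v, 'e) pre_digraph \<Rightarrow> 'v \<Rightarrow> nat" where
  "valence G v = card (half_edges_at G v)"

definition linked :: "('v, 'e) pre_digraph \<Rightarrow> 'v \<Rightarrow> 'v \<Rightarrow> bool" where
  "linked G u v \<longleftrightarrow> reachable (with_proj (mk_symmetric G)) u v"

definition separating_edge :: "('v, 'e) pre_digraph \<Rightarrow> 'e \<Rightarrow> bool" where
  "separating_edge G e \<longleftrightarrow> e \<in> arcs G \<and>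
     \<not> linked (G\<lparr>arcs := arcs G - {e}\<rparr>) (tail G e) (head G e)"

text \<open>For connected \<open>G\<close>: the number of edges outside a maximal tree, i.e. \<open>1 - \<chi>(G)\<close>,
  is the rank of the free group \<open>\<pi>\<^sub>1(G)\<close>.\<close>

definition has_rank :: "('v, 'e) pre_digraph \<Rightarrow> nat \<Rightarrow> bool" where
  "has_rank G r \<longleftrightarrow> card (arcs G) + 1 = card (verts G) + r"

text \<open>
  The library's \<open>cycle\<close>, \<open>tree\<close> and \<open>spanning_tree\<close> refer to directed cycles, so they do not
  apply here. A circuit is a closed walk without repeated edges; the entry \<open>(e, b)\<close> means that
  \<open>e\<close> is traversed starting from its end \<open>(e, b)\<close>.
\<close>

definition circuit :: "('v, 'e) pre_digraph \<Rightarrow> ('e \<times> bool) list \<Rightarrow> bool" where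
  "circuit G w \<longleftrightarrow> w \<noteq> [] \<and> distinct (map fst w) \<and> fst ` set w \<subseteq> arcs G \<and>
     (\<forall>i < length w. end_of G (fst (w ! i), \<not> snd (w ! i)) = end_of G (w ! (Suc i mod length w)))"

definition maximal_tree :: "('v, 'e) pre_digraph \<Rightarrow> 'e set \<Rightarrow> bool" where
  "maximal_tree G T \<longleftrightarrow> T \<subseteq> arcs G \<and> connected (G\<lparr>arcs := T\<rparr>) \<and>
     (\<nexists>w. circuit (G\<lparr>arcs := T\<rparr>) w)"

text \<open>
  Collapsing the edges in \<open>F\<close> identifies each component of the graph \<open>(verts G, F)\<close> to a single
  vertex, represented by a chosen member of the component.
\<close>

definition collapse_vertex :: "('v, 'e) pre_digraph \<Rightarrow> 'e set \<Rightarrow> 'v \<Rightarrow> 'v" where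
  "collapse_vertex G F v = (SOME u. linked (G\<lparr>arcs := F\<rparr>) v u)"

definition collapse :: "('v, 'e) pre_digraph \<Rightarrow> 'e set \<Rightarrow> ('v, 'e) pre_digraph" where
  "collapse G F = \<lparr>verts = collapse_vertex G F ` verts G, arcs = arcs G - F,
     tail = collapse_vertex G F \<circ> tail G, head = collapse_vertex G F \<circ> head G\<rparr>"

definition graph_iso :: "('v, 'e) pre_digraph \<Rightarrow> ('w, 'f) pre_digraph \<Rightarrow> ('v \<Rightarrow> 'w) \<Rightarrow> ('e \<Rightarrow> 'f) \<Rightarrow> bool"
where
  "graph_iso G H \<phi> \<psi> \<longleftrightarrow> bij_betw \<phi> (verts G) (verts H) \<and> bij_betw \<psi> (arcs G) (arcs H) \<and>
     (\<forall>e \<in> arcs G. {tail H (\<psi> e), head H (\<psi> e)} = {\<phi> (tail G e), \<phi> (head G e)})"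

section \<open>Filtered graphs\<close>

text \<open>
  A core graph has no isolated vertices, so a core subgraph is determined by its set of edges;
  core subgraphs are represented by their edge sets throughout. Core graphs are taken to be
  nonempty: otherwise the empty graph could be inserted at the bottom of every filtration.
\<close>

definition edge_subgraph :: "('v, 'e) pre_digraph \<Rightarrow> 'e set \<Rightarrow> ('v, 'e) pre_digraph" where
  "edge_subgraph G S = G\<lparr>verts := tail G ` S \<union> head G ` S, arcs := S\<rparr>"

definition core_graph :: "('v, 'e) pre_digraph \<Rightarrow> bool" where
  "core_graph H \<longleftrightarrow> verts H \<noteq> {} \<and> (\<forall>v \<in> verts H. 2 \<le> valence H v) \<and>
     (\<nexists>e. separating_edge H e)"

definition proper_core :: "('v, 'e) pre_digraph \<Rightarrow> 'e set \<Rightarrow> bool" where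
  "proper_core G S \<longleftrightarrow> S \<subset> arcs G \<and> core_graph (edge_subgraph G S)"

text \<open>
  \<open>filt\<close> lists the proper terms \<open>G\<^sub>1 \<subset> \<dots> \<subset> G\<^bsub>k-1\<^esub>\<close> of the filtration; the last term
  \<open>G\<^sub>k = G\<close> is left implicit. \<open>ord\<close> is the ordering of the edges that gives the orientation.
\<close>

record ('v, 'e) filtered_graph =
  carrier_graph :: "('v, 'e) pre_digraph"
  filt :: "'e set list"
  ord :: "'e list"

definition filtration_length :: "('v, 'e) filtered_graph \<Rightarrow> nat" where
  "filtration_length Y = length (filt Y) + 1"

definition filtered_graphs :: "nat \<Rightarrow> ('v, 'e) filtered_graph set" where
  "filtered_graphs r = {Y.
     fin_digraph (carrier_graph Y) \<and> connected (carrier_graph Y) \<and> has_rank (carrier_graph Y) r \<and>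
     (\<forall>v \<in> verts (carrier_graph Y). 3 \<le> valence (carrier_graph Y) v) \<and>
     (\<forall>S \<in> set (filt Y). proper_core (carrier_graph Y) S) \<and> sorted_wrt (\<subset>) (filt Y) \<and>
     distinct (ord Y) \<and> set (ord Y) = arcs (carrier_graph Y)}"

section \<open>The chain complex\<close>

definition qscale :: "rat \<Rightarrow> ('a \<Rightarrow>\<^sub>0 rat) \<Rightarrow> ('a \<Rightarrow>\<^sub>0 rat)" where
  "qscale c x = Poly_Mapping.map ((*) c) x"

lemma lookup_qscale: "Poly_Mapping.lookup (qscale c x) a = c * Poly_Mapping.lookup x a"
  by (simp add: qscale_def Poly_Mapping.map.rep_eq when_def)

interpretation chain: vector_space "qscale :: rat \<Rightarrow> ('a \<Rightarrow>\<^sub>0 rat) \<Rightarrow> ('a \<Rightarrow>\<^sub>0 rat)"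
  by unfold_locales (auto intro!: poly_mapping_eqI simp: lookup_qscale lookup_add algebra_simps)

text \<open>
  \<open>B r\<close> is the quotient of the free vector space \<open>chains r\<close> on oriented filtered \<open>r\<close>-graphs by
  the span of the relations \<open>Y = sgn(p) Y'\<close>, one for each isomorphism \<open>Y \<rightarrow> Y'\<close> of filtered
  graphs, where \<open>p\<close> is the permutation by which the edge ordering of \<open>Y'\<close> differs from the image
  of that of \<open>Y\<close>. (For an identity isomorphism these are the relations for changes of
  orientation.) Vertices and edges are drawn from the types \<open>'v\<close> and \<open>'e\<close>; as soon as these are
  infinite all isomorphism classes occur. The elements of \<open>B r\<close> are equivalence classes of chains.
\<close>

definition chains :: "nat \<Rightarrow> (('v, 'e) filtered_graph \<Rightarrow>\<^sub>0 rat) set" where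
  "chains r = {c. Poly_Mapping.keys c \<subseteq> filtered_graphs r}"

definition relations :: "nat \<Rightarrow> (('v, 'e) filtered_graph \<Rightarrow>\<^sub>0 rat) set" where
  "relations r = {Poly_Mapping.single Y 1 - Poly_Mapping.single Y' (of_int (sign p)) | Y Y' p.
     Y \<in> filtered_graphs r \<and> Y' \<in> filtered_graphs r \<and> p permutes {..<length (ord Y)} \<and>
     (\<exists>\<phi> \<psi>. graph_iso (carrier_graph Y) (carrier_graph Y') \<phi> \<psi> \<and>
        filt Y' = map (image \<psi>) (filt Y) \<and> ord Y' = permute_list p (map \<psi> (ord Y)))}"

definition B_rel :: "nat \<Rightarrow> (('v, 'e) filtered_graph \<Rightarrow>\<^sub>0 rat) rel" where
  "B_rel r = {(x, y). x \<in> chains r \<and> y \<in> chains r \<and> x - y \<in> chain.span (relations r)}"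

definition B :: "nat \<Rightarrow> (('v, 'e) filtered_graph \<Rightarrow>\<^sub>0 rat) set set" where
  "B r = chains r // B_rel r"

definition B_class ::
  "nat \<Rightarrow> (('v, 'e) filtered_graph \<Rightarrow>\<^sub>0 rat) \<Rightarrow> (('v, 'e) filtered_graph \<Rightarrow>\<^sub>0 rat) set" where
  "B_class r x = B_rel r `` {x}"

definition insertable :: "('v, 'e) filtered_graph \<Rightarrow> 'e set set" where
  "insertable Y = {C. proper_core (carrier_graph Y) C \<and> (\<forall>S \<in> set (filt Y). S \<subset> C \<or> C \<subset> S)}"

definition insert_core :: "('v, 'e) filtered_graph \<Rightarrow> 'e set \<Rightarrow> ('v, 'e) filtered_graph" where
  "insert_core Y C =
     Y\<lparr>filt := filter (\<lambda>S. S \<subset> C) (filt Y) @ C # filter (\<lambda>S. C \<subset> S) (filt Y)\<rparr>"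

definition core_position :: "('v, 'e) filtered_graph \<Rightarrow> 'e set \<Rightarrow> nat" where
  "core_position Y C = length (filter (\<lambda>S. S \<subset> C) (filt Y)) + 1"

definition dF_gen :: "('v, 'e) filtered_graph \<Rightarrow> (('v, 'e) filtered_graph \<Rightarrow>\<^sub>0 rat)" where
  "dF_gen Y = (\<Sum>C \<in> insertable Y. Poly_Mapping.single (insert_core Y C) ((-1) ^ core_position Y C))"

text \<open>The pairs in the \<open>zip\<close> are \<open>(G\<^bsub>i-1\<^esub>, G\<^sub>i)\<close> for \<open>1 \<le> i \<le> k\<close>, with \<open>G\<^sub>0\<close> empty.\<close>

definition collapsible :: "('v, 'e) filtered_graph \<Rightarrow> 'e \<Rightarrow> bool" where
  "collapsible Y e \<longleftrightarrow> e \<in> arcs (carrier_graph Y) \<and> tail (carrier_graph Y) e \<noteq> head (carrier_graph Y) e \<and>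
     (\<forall>(S, S') \<in> set (zip ({} # filt Y) (filt Y @ [arcs (carrier_graph Y)])). S' - S \<noteq> {e})"

definition collapse_edge :: "('v, 'e) filtered_graph \<Rightarrow> 'e \<Rightarrow> ('v, 'e) filtered_graph" where
  "collapse_edge Y e = \<lparr>carrier_graph = collapse (carrier_graph Y) {e}, filt = map (\<lambda>S. S - {e}) (filt Y),
     ord = filter (\<lambda>x. x \<noteq> e) (ord Y)\<rparr>"

text \<open>The edge \<open>ord Y ! i\<close> has position \<open>i + 1\<close> in the ordering.\<close>

definition dE_gen :: "('v, 'e) filtered_graph \<Rightarrow> (('v, 'e) filtered_graph \<Rightarrow>\<^sub>0 rat)" where
  "dE_gen Y = (\<Sum>i | i < length (ord Y) \<and> collapsible Y (ord Y ! i).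
     Poly_Mapping.single (collapse_edge Y (ord Y ! i)) ((-1) ^ ((i + 1) + filtration_length Y - 1)))"

text \<open>\<open>boundary\<close> is the differential \<open>d = d\<^sub>E + d\<^sub>F\<close> on representatives; the differential on
  \<open>B r\<close> sends the class of a chain \<open>c\<close> to the class of \<open>boundary c\<close>.\<close>

definition boundary ::
  "(('v, 'e) filtered_graph \<Rightarrow>\<^sub>0 rat) \<Rightarrow> (('v, 'e) filtered_graph \<Rightarrow>\<^sub>0 rat)" where
  "boundary c = (\<Sum>Y \<in> Poly_Mapping.keys c. qscale (Poly_Mapping.lookup c Y) (dE_gen Y + dF_gen Y))"

section \<open>AB-graphs\<close>

text \<open>\<open>A\<close> is the set of type A vertices; all other vertices have type B.\<close>

definition AB_graph :: "('v, 'e) pre_digraph \<Rightarrow> 'v set \<Rightarrow> bool" where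
  "AB_graph X A \<longleftrightarrow> fin_digraph X \<and> connected X \<and> (\<forall>v \<in> verts X. 3 \<le> valence X v) \<and> A \<subseteq> verts X"

definition odd_AB_graph :: "('v, 'e) pre_digraph \<Rightarrow> 'v set \<Rightarrow> bool" where
  "odd_AB_graph X A \<longleftrightarrow> AB_graph X A \<and> (\<forall>s \<in> A. odd (valence X s))"

definition AB_orientation ::
  "('v, 'e) pre_digraph \<Rightarrow> 'v set \<Rightarrow> ('v \<Rightarrow> ('e \<times> bool) list) \<Rightarrow> bool" where
  "AB_orientation X A h \<longleftrightarrow> (\<forall>s \<in> A. distinct (h s) \<and> set (h s) = half_edges_at X s)"

section \<open>The chain associated with an oriented odd AB-graph\<close>

text \<open>
  If \<open>a\<close> is the number of type A vertices of \<open>X\<close> and \<open>k\<close> the number of edges outside the maximal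
  tree, then the graphs \<open>Y_graph X A T o1 o2 \<iota>\<close> below have rank \<open>a + k\<close>.
  The polygon at \<open>s\<close> has vertices \<open>Corner s i\<close> and edges \<open>Side s i\<close>, \<open>i < valence X s\<close>, where
  \<open>Side s i\<close> joins \<open>Corner s i\<close> to its cyclic successor. \<open>attachings X s\<close> is the set \<open>I\<^sub>s\<close>.
\<close>

datatype 'v blowup_vertex = Plain 'v | Corner 'v nat

datatype ('v, 'e) blowup_edge = Side 'v nat | Old 'e

definition attachings :: "('v, 'e) pre_digraph \<Rightarrow> 'v \<Rightarrow> ('e \<times> bool \<Rightarrow> nat) set" where
  "attachings X s = {f \<in> extensional (half_edges_at X s).
     bij_betw f (half_edges_at X s) {..<valence X s}}"

definition attaching_sign :: "('e \<times> bool) list \<Rightarrow> ('e \<times> bool \<Rightarrow> nat) \<Rightarrow> int" where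
  "attaching_sign xs f = sign (\<lambda>i. if i < length xs then f (xs ! i) else i)"

definition attach ::
  "('v, 'e) pre_digraph \<Rightarrow> 'v set \<Rightarrow> ('v \<Rightarrow> 'e \<times> bool \<Rightarrow> nat) \<Rightarrow> 'e \<times> bool \<Rightarrow> 'v blowup_vertex" where
  "attach X A \<iota> x =
     (if end_of X x \<in> A then Corner (end_of X x) (\<iota> (end_of X x) x) else Plain (end_of X x))"

definition sides :: "('v, 'e) pre_digraph \<Rightarrow> 'v \<Rightarrow> ('v, 'e) blowup_edge list" where
  "sides X s = map (Side s) [0..<valence X s]"

definition blowup ::
  "('v, 'e) pre_digraph \<Rightarrow> 'v set \<Rightarrow> ('v \<Rightarrow> 'e \<times> bool \<Rightarrow> nat) \<Rightarrow>
     ('v blowup_vertex, ('v, 'e) blowup_edge) pre_digraph" where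
  "blowup X A \<iota> = \<lparr>
     verts = Plain ` (verts X - A) \<union> {Corner s i | s i. s \<in> A \<and> i < valence X s},
     arcs = (\<Union>s \<in> A. set (sides X s)) \<union> Old ` arcs X,
     tail = (\<lambda>d. case d of Side s i \<Rightarrow> Corner s i | Old e \<Rightarrow> attach X A \<iota> (e, False)),
     head = (\<lambda>d. case d of Side s i \<Rightarrow> Corner s (Suc i mod valence X s)
                         | Old e \<Rightarrow> attach X A \<iota> (e, True))\<rparr>"

definition Y_graph ::
  "('v, 'e) pre_digraph \<Rightarrow> 'v set \<Rightarrow> 'e set \<Rightarrow> 'v list \<Rightarrow> 'e list \<Rightarrow> ('v \<Rightarrow> 'e \<times> bool \<Rightarrow> nat) \<Rightarrow>
     ('v blowup_vertex, ('v, 'e) blowup_edge) filtered_graph" where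
  "Y_graph X A T o1 o2 \<iota> = \<lparr>
     carrier_graph = collapse (blowup X A \<iota>) (Old ` T),
     filt =
       map (\<lambda>i. \<Union>s \<in> set (take i o1). set (sides X s)) [1..<length o1 + 1] @
       map (\<lambda>j. (\<Union>s \<in> set o1. set (sides X s)) \<union> Old ` set (take j o2)) [1..<length o2],
     ord = concat (map (sides X) o1) @ map Old o2\<rparr>"

definition Phi ::
  "('v, 'e) pre_digraph \<Rightarrow> 'v set \<Rightarrow> ('v \<Rightarrow> ('e \<times> bool) list) \<Rightarrow> 'e set \<Rightarrow> 'v list \<Rightarrow> 'e list \<Rightarrow>
     (('v blowup_vertex, ('v, 'e) blowup_edge) filtered_graph \<Rightarrow>\<^sub>0 rat)" where
  "Phi X A h T o1 o2 = (\<Sum>\<iota> \<in> (\<Pi>\<^sub>E s \<in> A. attachings X s).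
     Poly_Mapping.single (Y_graph X A T o1 o2 \<iota>) (of_int (\<Prod>s \<in> A. attaching_sign (h s) (\<iota> s))))"

end

theory Submission
  imports Defs
begin

text \<open>
  The filtration of \<open>Y[\<iota>]\<close> has as many terms as the rank of \<open>Y[\<iota>]\<close>, all of them core graphs. First
  Betti numbers increase strictly along a chain of core graphs, so nothing can be inserted and
  \<open>d\<^sub>F\<close> vanishes on every \<open>Y[\<iota>]\<close>. The edges \<open>e\<^sub>j\<close> are whole steps of the filtration, so only polygon
  sides contribute to \<open>d\<^sub>E\<close>. Exchanging the two half-edges attached at the ends of a side changes the sign
  of \<open>\<iota>\<close> but not the graph obtained by collapsing that side, so these terms cancel in pairs.
\<close>

section \<open>Connectivity by a set of edges\<close>

text \<open>A collapse picks an arbitrary representative of each component, so the two graphs that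
  should cancel are isomorphic but not equal, and their vertices have no usable description. Every
  question about a quotient is therefore pulled back to the uncollapsed graph, where collapsing
  \<open>F\<close> only means that the edges of \<open>F\<close> become available for free. For this
  reason bridges, forests, components and core graphs are all phrased through one relation, being
  joined by a given set of edges of a fixed graph.

  The relations that define \<open>B r\<close> connect members of \<open>filtered_graphs r\<close>
  only, so rank, valences and core filtration have to be verified for every blown-up graph and for
  each of its edge collapses before any cancellation can be stated.

  A side may turn into a loop when the tree is collapsed, and then it has no term in the
  differential; the exchange of half-edges must be shown to respect this. The edge at a given
  position of the ordering is the same for all \<iota>, so the cancellation is carried out position
  by position, each side having its own involution.\<close>

text \<open>In contrast to \<open>linked\<close>, no vertex set enters and the edge set is a
  separate parameter, so that deleting or adding edges does not change the graph.\<close>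

definition joined :: "('v, 'e) pre_digraph \<Rightarrow> 'e set \<Rightarrow> 'v \<Rightarrow> 'v \<Rightarrow> bool" where
  "joined G S u v \<longleftrightarrow> (u, v) \<in> (\<Union>e\<in>S. {(tail G e, head G e), (head G e, tail G e)})\<^sup>*"

lemma joined_refl [simp]: "joined G S u u"
  by (simp add: joined_def)

lemma joined_trans [trans]: "joined G S u v \<Longrightarrow> joined G S v w \<Longrightarrow> joined G S u w"
  unfolding joined_def by (rule rtrancl_trans)

lemma joined_sym: "joined G S u v \<Longrightarrow> joined G S v u"
  unfolding joined_def by (rule symD[OF sym_rtrancl]) (auto intro!: symI)

lemma joined_mono: "joined G S u v \<Longrightarrow> S \<subseteq> S' \<Longrightarrow> joined G S' u v"
  unfolding joined_def by (erule rev_subsetD, rule rtrancl_mono) auto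

lemma joined_edge: "e \<in> S \<Longrightarrow> joined G S (tail G e) (head G e)"
  unfolding joined_def by (rule r_into_rtrancl) auto

text \<open>Steps are taken along half-edges: the flag \<open>b\<close> records the direction, so
  both directions of an edge form a single case.\<close>

lemma joined_induct [consumes 1, case_names refl step]:
  assumes "joined G S u v" and "P u"
    and "\<And>e b. e \<in> S \<Longrightarrow> joined G S u (end_of G (e, b)) \<Longrightarrow> P (end_of G (e, b)) \<Longrightarrow> P (end_of G (e, \<not> b))"
  shows "P v"
  using assms(1) unfolding joined_def
proof (induction rule: rtrancl_induct)
  case (step y z)
  then obtain e where e: "e \<in> S" "(y, z) = (tail G e, head G e) \<or> (y, z) = (head G e, tail G e)"
    by auto
  moreover have "joined G S u y"
    using step.hyps(1) by (simp add: joined_def)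
  ultimately show ?case
    using assms(3)[of e True] assms(3)[of e False] step.IH by auto
qed (fact assms(2))

text \<open>Connections are carried along any vertex map that keeps the ends of each edge joined. It
  serves collapses, the projection of a blown-up graph to \<open>X\<close>, lifts in the other
  direction, and the transposition of two corners.\<close>

lemma joined_map:
  assumes "joined G S u v" and "\<And>e. e \<in> S \<Longrightarrow> joined H S' (f (tail G e)) (f (head G e))"
  shows "joined H S' (f u) (f v)"
  using assms(1)
proof (induction rule: joined_induct)
  case (step e b)
  then show ?case
    using assms(2)[OF step.hyps(1)] by (cases b) (auto intro: joined_trans joined_sym)
qed simp

lemma joined_cong:
  assumes "\<And>e. e \<in> S \<Longrightarrow> tail G e = tail H e" "\<And>e. e \<in> S \<Longrightarrow> head G e = head H e"
  shows "joined G S = joined H S"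
  unfolding joined_def using assms by (auto cong: image_cong intro!: ext)

lemma joined_arcs_update [simp]: "joined (G\<lparr>arcs := F\<rparr>) S = joined G S"
  by (rule joined_cong) auto

lemma joined_in_verts:
  assumes "wf_digraph G" "S \<subseteq> arcs G" "joined G S u v" "u \<in> verts G"
  shows "v \<in> verts G"
  using assms(3)
proof (induction rule: joined_induct)
  case (step e b)
  then show ?case
    using assms(1,2) by (cases b) (auto simp: wf_digraph_def)
qed (fact assms(4))

text \<open>A connection that passes through \<open>e\<close> can be shortened until it uses
  \<open>e\<close> at most once, in one of its two directions.\<close>

lemma joined_insert:
  "joined G (insert e S) u v \<longleftrightarrow> joined G S u v
     \<or> joined G S u (tail G e) \<and> joined G S (head G e) v
     \<or> joined G S u (head G e) \<and> joined G S (tail G e) v" (is "?L \<longleftrightarrow> ?R v")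
proof
  assume ?L
  then show "?R v"
  proof (induction rule: joined_induct)
    case (step f b)
    show ?case
    proof (cases "f = e")
      case True
      with step.IH show ?thesis
        by (cases b) (auto intro: joined_trans joined_sym)
    next
      case False
      with step.hyps have "joined G S (tail G f) (head G f)"
        by (auto intro: joined_edge)
      then have "joined G S (end_of G (f, b)) (end_of G (f, \<not> b))"
        by (cases b) (auto intro: joined_sym)
      with step.IH show ?thesis
        by (meson joined_trans)
    qed
  qed simp
next
  have e: "joined G (insert e S) (tail G e) (head G e)"
    by (rule joined_edge) simp
  have *: "joined G S x y \<Longrightarrow> joined G (insert e S) x y" for x y
    by (erule joined_mono) auto
  assume "?R v"
  then show ?L
    by (meson * e joined_sym joined_trans)
qed

text \<open>Only the start has to be required in \<open>verts H\<close>; well-formedness keeps all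
  later vertices there.\<close>

lemma linked_iff:
  assumes "wf_digraph H"
  shows "linked H u v \<longleftrightarrow> u \<in> verts H \<and> joined H (arcs H) u v"
proof
  assume "linked H u v"
  then have "(u, v) \<in> rtrancl_on (verts H) (parcs (mk_symmetric H))"
    by (simp add: linked_def reachable_def)
  then show "u \<in> verts H \<and> joined H (arcs H) u v"
  proof (induction rule: rtrancl_on_induct)
    case (step y z)
    then show ?case
      unfolding joined_def parcs_mk_symmetric by (blast intro: rtrancl_into_rtrancl)
  qed simp
next
  assume *: "u \<in> verts H \<and> joined H (arcs H) u v"
  then have "joined H (arcs H) u v" by blast
  then have "(u, v) \<in> rtrancl_on (verts H) (parcs (mk_symmetric H))"
  proof (induction rule: joined_induct)
    case (step e b)
    have "(end_of H (e, b), end_of H (e, \<not> b)) \<in> parcs (mk_symmetric H)"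
      using step.hyps(1) by (cases b) (auto simp: parcs_mk_symmetric)
    moreover have "end_of H (e, \<not> b) \<in> verts H"
      using assms step.hyps(1) by (cases b) (auto simp: wf_digraph_def)
    ultimately show ?case
      using rtrancl_on_into_rtrancl_on step.IH by metis
  qed (use * in simp)
  then show "linked H u v"
    by (simp add: linked_def reachable_def)
qed

lemma linked_arcs_update_iff:
  assumes "wf_digraph G" "S \<subseteq> arcs G"
  shows "linked (G\<lparr>arcs := S\<rparr>) u v \<longleftrightarrow> u \<in> verts G \<and> joined G S u v"
proof -
  have "wf_digraph (G\<lparr>arcs := S\<rparr>)"
    using assms by (auto simp: wf_digraph_def)
  then show ?thesis
    by (simp add: linked_iff)
qed

lemma connected_iff:
  assumes "wf_digraph H"
  shows "connected H \<longleftrightarrow> verts H \<noteq> {} \<and> (\<forall>u\<in>verts H. \<forall>v\<in>verts H. joined H (arcs H) u v)"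
proof -
  have "connected H \<longleftrightarrow> verts H \<noteq> {} \<and> (\<forall>u\<in>verts H. \<forall>v\<in>verts H. linked H u v)"
    by (simp add: connected_def strongly_connected_def linked_def)
  then show ?thesis
    using linked_iff[OF assms] by auto
qed

section \<open>Forests and Betti numbers\<close>

text \<open>Forests, described by every edge being a bridge. This form passes to subsets and
  supports induction over edges, which the circuits of \<open>maximal_tree\<close> do not do
  directly.\<close>

definition acyclic_edges :: "('v, 'e) pre_digraph \<Rightarrow> 'e set \<Rightarrow> bool" where
  "acyclic_edges G F \<longleftrightarrow> (\<forall>e\<in>F. \<not> joined G (F - {e}) (tail G e) (head G e))"

lemma acyclic_edges_subset: "acyclic_edges G F \<Longrightarrow> F' \<subseteq> F \<Longrightarrow> acyclic_edges G F'"
  unfolding acyclic_edges_def by (meson Diff_mono joined_mono order_refl subsetD)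

section \<open>Walks without repeated edges, and circuits\<close>

definition trail :: "('v, 'e) pre_digraph \<Rightarrow> 'e set \<Rightarrow> 'v \<Rightarrow> ('e \<times> bool) list \<Rightarrow> 'v \<Rightarrow> bool" where
  "trail G S u w v \<longleftrightarrow> distinct (map fst w) \<and> fst ` set w \<subseteq> S
     \<and> (\<forall>i<length w. end_of G (w ! i) = (if i = 0 then u else end_of G (fst (w ! (i - 1)), \<not> snd (w ! (i - 1)))))
     \<and> v = (if w = [] then u else end_of G (fst (last w), \<not> snd (last w)))"

lemma trail_take:
  assumes "trail G S u w v" "i \<le> length w" "0 < i"
  shows "trail G S u (take i w) (end_of G (fst (w ! (i - 1)), \<not> snd (w ! (i - 1))))"
proof -
  have ne: "take i w \<noteq> []"
    using assms(2,3) by auto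
  moreover have "last (take i w) = w ! (i - 1)"
    using assms(2,3) unfolding last_conv_nth[OF ne] by (simp add: min_absorb2)
  ultimately show ?thesis
    using assms unfolding trail_def
    by (auto simp: take_map[symmetric] dest: in_set_takeD)
qed

lemma trail_snoc:
  assumes "trail G S u w (end_of G (e, b))" "e \<in> S" "e \<notin> fst ` set w"
  shows "trail G S u (w @ [(e, b)]) (end_of G (e, \<not> b))"
  unfolding trail_def
proof (intro conjI allI impI)
  fix i assume i: "i < length (w @ [(e, b)])"
  show "end_of G ((w @ [(e, b)]) ! i) = (if i = 0 then u
      else end_of G (fst ((w @ [(e, b)]) ! (i - 1)), \<not> snd ((w @ [(e, b)]) ! (i - 1))))"
  proof (cases "i < length w")
    case True
    then have "end_of G (w ! i) = (if i = 0 then u else end_of G (fst (w ! (i - 1)), \<not> snd (w ! (i - 1))))"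
      using assms(1) unfolding trail_def by blast
    then show ?thesis using True by (cases i) (simp_all add: nth_append del: end_of.simps)
  next
    case False
    then have "i = length w" using i by simp
    moreover have "end_of G (e, b) = (if w = [] then u else end_of G (fst (last w), \<not> snd (last w)))"
      using assms(1) unfolding trail_def by blast
    ultimately show ?thesis
      by (cases "w = []") (simp_all add: nth_append last_conv_nth del: end_of.simps)
  qed
qed (use assms in \<open>auto simp: trail_def\<close>)

text \<open>When the next edge has already been used, the walk is cut back: just after the earlier
  passage if that had the same direction, just before it if the direction was opposite. Either cut
  ends at the desired vertex.\<close>

lemma joined_imp_trail:
  assumes "joined G S u v"
  shows "\<exists>w. trail G S u w v"
  using assms
proof (induction rule: joined_induct)
  case refl
  then show ?case by (auto intro!: exI[of _ "[]"] simp: trail_def)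
next
  case (step e b)
  then obtain w where w: "trail G S u w (end_of G (e, b))" by blast
  show ?case
  proof (cases "e \<in> fst ` set w")
    case False
    then show ?thesis using trail_snoc[OF w step.hyps(1)] by blast
  next
    case True
    then obtain i c where i: "i < length w" "w ! i = (e, c)"
      by (auto simp: in_set_conv_nth)
    show ?thesis
    proof (cases "c = b")
      case True
      then show ?thesis
        using trail_take[OF w, of "Suc i"] i by auto
    next
      case False
      then have c: "c = (\<not> b)" by auto
      have "end_of G (w ! i) = (if i = 0 then u else end_of G (fst (w ! (i - 1)), \<not> snd (w ! (i - 1))))"
        using w i(1) unfolding trail_def by blast
      then have wi: "end_of G (e, \<not> b) = (if i = 0 then u else end_of G (fst (w ! (i - 1)), \<not> snd (w ! (i - 1))))"
        using i(2) c by (simp del: end_of.simps)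
      show ?thesis
      proof (cases "i = 0")
        case True
        then have "u = end_of G (e, \<not> b)"
          using wi by (simp del: end_of.simps)
        then show ?thesis by (auto intro!: exI[of _ "[]"] simp: trail_def)
      next
        case False
        then have "end_of G (e, \<not> b) = end_of G (fst (w ! (i - 1)), \<not> snd (w ! (i - 1)))"
          using wi by (simp del: end_of.simps)
        then show ?thesis
          using trail_take[OF w, of i] i False by (metis less_imp_le neq0_conv)
      qed
    qed
  qed
qed

text \<open>If the ends of \<open>e\<close> remain joined without \<open>e\<close>, a trail from
  tail to head avoiding \<open>e\<close>, closed up by \<open>(e, True)\<close>, which runs from the
  head back to the tail, is a circuit.\<close>

lemma acyclic_edges_if_no_circuit:
  assumes "\<nexists>w. circuit (G\<lparr>arcs := T\<rparr>) w"
  shows "acyclic_edges G T"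
  unfolding acyclic_edges_def
proof (intro ballI notI)
  fix e assume e: "e \<in> T" and "joined G (T - {e}) (tail G e) (head G e)"
  from joined_imp_trail[OF this(2)] obtain w where w: "trail G (T - {e}) (tail G e) w (head G e)"
    by blast
  have eo: "end_of (G\<lparr>arcs := T\<rparr>) = end_of G"
    by (auto intro!: ext)
  have "trail G T (tail G e) w (end_of G (e, True))"
    using w unfolding trail_def by auto
  moreover have "e \<notin> fst ` set w" using w unfolding trail_def by auto
  ultimately have w': "trail G T (tail G e) (w @ [(e, True)]) (tail G e)"
    using trail_snoc[of G T _ w e True] e by simp
  have "circuit (G\<lparr>arcs := T\<rparr>) (w @ [(e, True)])" (is "circuit _ ?w")
    unfolding circuit_def eo
  proof (intro conjI allI impI)
    fix i assume i: "i < length ?w"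
    show "end_of G (fst (?w ! i), \<not> snd (?w ! i)) = end_of G (?w ! (Suc i mod length ?w))"
    proof (cases "Suc i = length ?w")
      case True
      then have "end_of G (?w ! 0) = tail G e" "end_of G (fst (?w ! i), \<not> snd (?w ! i)) = tail G e"
        using w' unfolding trail_def by (auto simp: last_conv_nth)
      then show ?thesis using True by simp
    next
      case False
      then have "Suc i < length ?w" using i by simp
      moreover from this have "end_of G (?w ! (Suc i)) = end_of G (fst (?w ! i), \<not> snd (?w ! i))"
        using w' unfolding trail_def by (metis diff_Suc_1 nat.distinct(1))
      ultimately show ?thesis by simp
    qed
  qed (use w' in \<open>auto simp: trail_def\<close>)
  then show False using assms by blast
qed

section \<open>Counting components\<close>

lemma card_image_kernel:
  assumes "finite V" "\<And>u v. u \<in> V \<Longrightarrow> v \<in> V \<Longrightarrow> f u = f v \<longleftrightarrow> g u = g v"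
  shows "card (f ` V) = card (g ` V)"
proof -
  have "bij_betw (\<lambda>y. g (inv_into V f y)) (f ` V) (g ` V)"
  proof (rule bij_betw_imageI)
    have *: "g (inv_into V f (f v)) = g v" if "v \<in> V" for v
      using assms(2)[of "inv_into V f (f v)" v] that by (simp add: inv_into_into f_inv_into_f)
    show "inj_on (\<lambda>y. g (inv_into V f y)) (f ` V)"
      using assms(2) * by (auto simp: inj_on_def)
    show "(\<lambda>y. g (inv_into V f y)) ` f ` V = g ` V"
      unfolding image_image by (rule image_cong) (simp_all add: *)
  qed
  then show ?thesis by (rule bij_betw_same_card)
qed

text \<open>The number of components of the graph with edge set \<open>S\<close> on all of
  \<open>verts G\<close>, isolated vertices included.\<close>

definition ncomp :: "('v, 'e) pre_digraph \<Rightarrow> 'e set \<Rightarrow> nat" where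
  "ncomp G S = card ((\<lambda>v. {u \<in> verts G. joined G S v u}) ` verts G)"

lemma joined_class_eq_iff:
  assumes "v \<in> verts G"
  shows "{x \<in> verts G. joined G S u x} = {x \<in> verts G. joined G S v x} \<longleftrightarrow> joined G S u v"
  using assms by (auto intro: joined_trans joined_sym)

lemma ncomp_empty [simp]: "ncomp G {} = card (verts G)"
proof -
  have "joined G {} u v \<longleftrightarrow> u = v" for u v
    by (auto simp: joined_def)
  then have "inj_on (\<lambda>v. {u \<in> verts G. joined G {} v u}) (verts G)"
    by (auto simp: inj_on_def)
  then show ?thesis
    unfolding ncomp_def by (rule card_image)
qed

lemma ncomp_insert_joined:
  assumes "joined G S (tail G e) (head G e)"
  shows "ncomp G (insert e S) = ncomp G S"
proof -
  have "joined G (insert e S) u v \<longleftrightarrow> joined G S u v" for u v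
    unfolding joined_insert using assms by (meson joined_sym joined_trans)
  then show ?thesis
    by (simp add: ncomp_def)
qed

lemma ncomp_insert_not_joined:
  assumes "finite (verts G)" and V: "tail G e \<in> verts G" "head G e \<in> verts G"
    and not: "\<not> joined G S (tail G e) (head G e)"
  shows "Suc (ncomp G (insert e S)) = ncomp G S"
proof -
  define c where "c v = {u \<in> verts G. joined G S v u}" for v
  define d where "d v = {u \<in> verts G. joined G (insert e S) v u}" for v
  \<comment> \<open>\<open>f\<close> merges the class of the head of \<open>e\<close> into that of
    the tail. Then \<open>f \<circ> c\<close> has the same fibres as \<open>d\<close>, and its image
    has lost exactly one class.\<close>
  define f where "f C = (if C = c (head G e) then c (tail G e) else C)" for C
  have c: "c u = c v \<longleftrightarrow> joined G S u v" if "v \<in> verts G" for u v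
    unfolding c_def using that by (rule joined_class_eq_iff)
  have d: "d u = d v \<longleftrightarrow> joined G (insert e S) u v" if "v \<in> verts G" for u v
    unfolding d_def using that by (rule joined_class_eq_iff)
  have fc: "f (c u) = f (c v) \<longleftrightarrow> d u = d v" if "u \<in> verts G" "v \<in> verts G" for u v
    unfolding f_def d[OF that(2)] joined_insert using that V
    by (simp add: c) (meson not joined_sym joined_trans)
  have "c ` verts G = insert (c (head G e)) ((f \<circ> c) ` verts G)"
    using V by (auto simp: f_def)
  moreover have "c (head G e) \<notin> (f \<circ> c) ` verts G"
    using V not by (auto simp: f_def c dest: joined_sym split: if_splits)
  ultimately have "card (c ` verts G) = Suc (card ((f \<circ> c) ` verts G))"
    using assms(1) by simp
  moreover have "card ((f \<circ> c) ` verts G) = card (d ` verts G)"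
    using assms(1) fc by (intro card_image_kernel) auto
  ultimately show ?thesis
    by (simp add: ncomp_def c_def d_def)
qed

lemma ncomp_acyclic:
  assumes "fin_digraph G" "F \<subseteq> arcs G" "acyclic_edges G F"
  shows "ncomp G F + card F = card (verts G)"
proof -
  interpret fin_digraph G by fact
  have "finite F" using assms(2) finite_arcs finite_subset by blast
  then show ?thesis using assms(2,3)
  proof (induction F)
    case (insert e F)
    have "\<not> joined G F (tail G e) (head G e)"
      using insert.prems insert.hyps by (simp add: acyclic_edges_def)
    then have "Suc (ncomp G (insert e F)) = ncomp G F"
      using insert.prems by (intro ncomp_insert_not_joined) auto
    moreover have "acyclic_edges G F"
      using insert.prems acyclic_edges_subset by blast
    ultimately show ?case using insert by simp
  qed simp
qed

text \<open>The first Betti number. A vertex not touched by \<open>S\<close> counts once in each of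
  the last two terms, so the value is that of \<open>edge_subgraph G S\<close>, although all
  \<open>S\<close> share the vertex set of \<open>G\<close>. Integers avoid truncated
  subtraction.\<close>

definition betti :: "('v, 'e) pre_digraph \<Rightarrow> 'e set \<Rightarrow> int" where
  "betti G S = int (card S) + int (ncomp G S) - int (card (verts G))"

text \<open>A new edge either closes a cycle or merges two components; in the second case the two
  changes cancel.\<close>

lemma betti_insert:
  assumes "fin_digraph G" "finite S" "e \<in> arcs G" "e \<notin> S"
  shows "betti G (insert e S) = betti G S + (if joined G S (tail G e) (head G e) then 1 else 0)"
proof -
  interpret fin_digraph G by fact
  show ?thesis
    using ncomp_insert_joined[of G S e] ncomp_insert_not_joined[of G e S] assms
    by (auto simp: betti_def)
qed

lemma betti_mono:
  assumes "fin_digraph G" "S \<subseteq> S'" "S' \<subseteq> arcs G"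
  shows "betti G S \<le> betti G S'"
proof -
  interpret fin_digraph G by fact
  have "finite S'" using assms(3) finite_arcs by (rule finite_subset)
  then have "finite S" "finite (S' - S)" using assms(2) finite_subset by auto
  have "betti G S \<le> betti G (S \<union> R)" if "finite R" "R \<subseteq> S' - S" for R
    using that
  proof (induction R)
    case (insert e R)
    have "betti G (insert e (S \<union> R)) \<ge> betti G (S \<union> R)"
      using insert \<open>finite S\<close> assms by (subst betti_insert) auto
    then show ?case using insert by auto
  qed simp
  then have "betti G S \<le> betti G (S \<union> (S' - S))"
    using \<open>finite (S' - S)\<close> by blast
  then show ?thesis using assms(2) by (simp add: Un_absorb1)
qed

section \<open>Core subgraphs\<close>

text \<open>Absence of separating edges already forces valence at least 2: an edge at
  \<open>v\<close> is a loop and has both halves there, or its ends are joined without it, so that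
  another edge reaches \<open>v\<close>.\<close>

lemma core_graph_edge_subgraph_iff:
  assumes "fin_digraph G" "S \<subseteq> arcs G"
  shows "core_graph (edge_subgraph G S) \<longleftrightarrow>
    S \<noteq> {} \<and> (\<forall>e\<in>S. joined G (S - {e}) (tail G e) (head G e))" (is "_ \<longleftrightarrow> _ \<and> ?N")
proof -
  interpret fin_digraph G by fact
  let ?H = "edge_subgraph G S"
  have "finite S" using assms(2) finite_arcs finite_subset by blast
  have H: "verts ?H = tail G ` S \<union> head G ` S" "arcs ?H = S" "tail ?H = tail G" "head ?H = head G"
    by (auto simp: edge_subgraph_def)
  have eo: "end_of ?H = end_of G"
    by (auto intro!: ext simp: H)
  have wf: "wf_digraph ?H"
    by (auto simp: wf_digraph_def H)
  have "separating_edge ?H e \<longleftrightarrow> e \<in> S \<and> \<not> joined G (S - {e}) (tail G e) (head G e)" for e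
    using wf joined_cong[of "S - {e}" ?H G]
    by (auto simp: separating_edge_def H linked_arcs_update_iff)
  then have sep: "(\<nexists>e. separating_edge ?H e) \<longleftrightarrow> ?N"
    by blast
  have val: "2 \<le> valence ?H v" if N: ?N and v: "v \<in> verts ?H" for v
  proof -
    from v obtain e b where e: "e \<in> S" "end_of G (e, b) = v"
      unfolding H by (auto intro: that[of _ False] that[of _ True])
    have fin: "finite (half_edges_at ?H v)"
      using \<open>finite S\<close> by (auto simp: half_edges_at_def H)
    have eb: "(e, b) \<in> half_edges_at ?H v"
      using e by (simp add: half_edges_at_def H eo del: end_of.simps)
    obtain x where x: "x \<in> half_edges_at ?H v" "x \<noteq> (e, b)"
    proof (cases "tail G e = head G e")
      case True
      then have "end_of G (e, \<not> b) = v" using e by (cases b) auto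
      then have "(e, \<not> b) \<in> half_edges_at ?H v"
        using e by (simp add: half_edges_at_def H eo del: end_of.simps)
      then show ?thesis using that by blast
    next
      case False
      have "joined G (S - {e}) (tail G e) (head G e)" using N e by blast
      then have "joined G (S - {e}) (end_of G (e, \<not> b)) (end_of G (e, b))"
        by (cases b) (auto intro: joined_sym)
      \<comment> \<open>Either the connection arrives along an edge other than \<open>e\<close>, or
        it ends where it began; the latter is impossible since \<open>e\<close> is not a
        loop.\<close>
      then have "\<exists>f c. f \<in> S - {e} \<and> end_of G (f, c) = end_of G (e, b)
          \<or> end_of G (e, b) = end_of G (e, \<not> b)"
      proof (induction rule: joined_induct)
        case (step f c)
        then show ?case by blast
      qed blast
      then obtain f c where f: "f \<in> S - {e}" "end_of G (f, c) = v"
        using False e by (cases b) auto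
      then have "(f, c) \<in> half_edges_at ?H v"
        by (simp add: half_edges_at_def H eo del: end_of.simps)
      then show ?thesis using that[of "(f, c)"] f by auto
    qed
    have "card {(e, b), x} \<le> card (half_edges_at ?H v)"
      using fin eb x by (intro card_mono) auto
    then show ?thesis using x by (simp add: valence_def)
  qed
  show ?thesis
    unfolding core_graph_def sep using val by (auto simp: H)
qed

text \<open>Unlike \<open>proper_core\<close> this allows \<open>S = arcs G\<close>, so that the
  last term of a filtration can be treated like the others.\<close>

definition core_edges :: "('v, 'e) pre_digraph \<Rightarrow> 'e set \<Rightarrow> bool" where
  "core_edges G S \<longleftrightarrow> S \<noteq> {} \<and> S \<subseteq> arcs G \<and> (\<forall>e\<in>S. joined G (S - {e}) (tail G e) (head G e))"

lemma proper_core_iff: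
  assumes "fin_digraph G"
  shows "proper_core G S \<longleftrightarrow> core_edges G S \<and> S \<subset> arcs G"
  using core_graph_edge_subgraph_iff[OF assms, of S]
  by (auto simp: proper_core_def core_edges_def)

text \<open>An edge of \<open>S'\<close> outside \<open>S\<close> is not a bridge of
  \<open>S'\<close>; putting it back as the last edge closes a cycle.\<close>

lemma betti_less_core:
  assumes "fin_digraph G" "core_edges G S'" "S \<subset> S'"
  shows "betti G S < betti G S'"
proof -
  interpret fin_digraph G by fact
  obtain e where e: "e \<in> S'" "e \<notin> S" using assms(3) by blast
  have sub: "S' \<subseteq> arcs G" using assms(2) by (simp add: core_edges_def)
  then have "finite S'" using finite_arcs finite_subset by blast
  have "betti G S \<le> betti G (S' - {e})"
    using assms(1,3) e sub by (intro betti_mono) auto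
  moreover have "betti G (insert e (S' - {e})) = betti G (S' - {e}) + 1"
    using assms(1,2) e sub \<open>finite S'\<close> by (subst betti_insert) (auto simp: core_edges_def)
  ultimately show ?thesis using e by (simp add: insert_absorb)
qed

lemma core_chain_length:
  assumes "fin_digraph G" "sorted_wrt (\<subset>) L" "\<forall>S\<in>set L. core_edges G S"
  shows "int (length L) \<le> betti G (arcs G)"
proof -
  \<comment> \<open>The prefixed \<open>{}\<close> supplies the empty chain with a last term, of
    Betti number 0.\<close>
  have *: "int (length L) \<le> betti G (last ({} # L))"
    using assms(2,3)
  proof (induction L rule: rev_induct)
    case Nil
    then show ?case by (simp add: betti_def)
  next
    case (snoc S L)
    then have "last ({} # L) \<subset> S"
      by (auto simp: sorted_wrt_append core_edges_def)
    then have "betti G (last ({} # L)) < betti G S"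
      using betti_less_core[OF assms(1)] snoc.prems by simp
    then show ?case using snoc by (simp add: sorted_wrt_append)
  qed
  also have "\<dots> \<le> betti G (arcs G)"
    using assms by (intro betti_mono) (auto simp: core_edges_def)
  finally show ?thesis .
qed

section \<open>Collapsing edges\<close>

lemma tail_collapse [simp]: "tail (collapse G F) e = collapse_vertex G F (tail G e)"
  and head_collapse [simp]: "head (collapse G F) e = collapse_vertex G F (head G e)"
  and arcs_collapse [simp]: "arcs (collapse G F) = arcs G - F"
  and verts_collapse: "verts (collapse G F) = collapse_vertex G F ` verts G"
  by (simp_all add: collapse_def)

lemma end_of_collapse: "end_of (collapse G F) x = collapse_vertex G F (end_of G x)"
  by (cases x) auto

lemma joined_collapse_vertex:
  assumes "wf_digraph G" "F \<subseteq> arcs G" "v \<in> verts G"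
  shows "joined G F v (collapse_vertex G F v)"
proof -
  have "linked (G\<lparr>arcs := F\<rparr>) v v"
    using assms by (simp add: linked_arcs_update_iff)
  then have "linked (G\<lparr>arcs := F\<rparr>) v (collapse_vertex G F v)"
    unfolding collapse_vertex_def by (rule someI)
  then show ?thesis
    using assms by (simp add: linked_arcs_update_iff)
qed

text \<open>Joined vertices present the same predicate to \<open>SOME\<close> and so get the same
  representative. Conversely, every vertex is joined to its representative.\<close>

lemma collapse_vertex_eq_iff:
  assumes "wf_digraph G" "F \<subseteq> arcs G" "u \<in> verts G" "v \<in> verts G"
  shows "collapse_vertex G F u = collapse_vertex G F v \<longleftrightarrow> joined G F u v"
proof
  assume "joined G F u v"
  then have "joined G F u x \<longleftrightarrow> joined G F v x" for x
    by (meson joined_sym joined_trans)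
  then show "collapse_vertex G F u = collapse_vertex G F v"
    using assms by (simp add: collapse_vertex_def linked_arcs_update_iff)
next
  assume "collapse_vertex G F u = collapse_vertex G F v"
  then show "joined G F u v"
    using joined_collapse_vertex[OF assms(1,2)] assms(3,4) by (metis joined_sym joined_trans)
qed

lemma fin_digraph_collapse:
  assumes "fin_digraph G"
  shows "fin_digraph (collapse G F)"
proof -
  interpret fin_digraph G by fact
  show ?thesis by unfold_locales (auto simp: verts_collapse)
qed

text \<open>The dictionary between a quotient and the original graph. From left to right, each
  vertex is joined by \<open>F\<close> to its representative; from right to left, edges of
  \<open>F\<close> shrink to points.\<close>

lemma joined_collapse_iff:
  assumes wf: "wf_digraph G" and F: "F \<subseteq> arcs G" and S: "S \<subseteq> arcs G"
    and uv: "u \<in> verts G" "v \<in> verts G"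
  shows "joined (collapse G F) S (collapse_vertex G F u) (collapse_vertex G F v) \<longleftrightarrow> joined G (S \<union> F) u v"
    (is "joined ?C S (?c u) (?c v) \<longleftrightarrow> _")
proof
  have c: "joined G (S \<union> F) w (?c w)" if "w \<in> verts G" for w
    using joined_collapse_vertex[OF wf F that] by (rule joined_mono) simp
  have "joined G (S \<union> F) (?c (tail G e)) (?c (head G e))" if "e \<in> S" for e
  proof -
    have "tail G e \<in> verts G" "head G e \<in> verts G" "joined G (S \<union> F) (tail G e) (head G e)"
      using that S wf by (auto simp: wf_digraph_def intro: joined_edge)
    then show ?thesis by (meson c joined_sym joined_trans)
  qed
  moreover assume "joined ?C S (?c u) (?c v)"
  ultimately have "joined G (S \<union> F) (?c u) (?c v)"
    using joined_map[of ?C S "?c u" "?c v" G "S \<union> F" "\<lambda>x. x"] by simp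
  then show "joined G (S \<union> F) u v"
    using uv by (meson c joined_sym joined_trans)
next
  assume "joined G (S \<union> F) u v"
  then show "joined ?C S (?c u) (?c v)"
  proof (rule joined_map)
    fix e assume "e \<in> S \<union> F"
    then consider "e \<in> S" | "e \<in> F" by blast
    then show "joined ?C S (?c (tail G e)) (?c (head G e))"
    proof cases
      case 1
      then show ?thesis using joined_edge[of e S ?C] by simp
    next
      case 2
      then have "?c (tail G e) = ?c (head G e)"
        using F wf by (subst collapse_vertex_eq_iff) (auto simp: wf_digraph_def intro: joined_edge)
      then show ?thesis by simp
    qed
  qed
qed

lemma connected_collapse:
  assumes wf: "wf_digraph G" and F: "F \<subseteq> arcs G" and "connected G"
  shows "connected (collapse G F)"
proof -
  have wf': "wf_digraph (collapse G F)"
    using wf by (auto simp: wf_digraph_def verts_collapse)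
  have "joined (collapse G F) (arcs G - F) (collapse_vertex G F u) (collapse_vertex G F v)"
    if "u \<in> verts G" "v \<in> verts G" for u v
    using that assms F by (subst joined_collapse_iff) (auto simp: connected_iff Un_absorb2)
  then show ?thesis
    using assms(3) unfolding connected_iff[OF wf'] connected_iff[OF wf]
    by (auto simp: verts_collapse)
qed

lemma card_verts_collapse:
  assumes "fin_digraph G" "F \<subseteq> arcs G"
  shows "card (verts (collapse G F)) = ncomp G F"
proof -
  interpret fin_digraph G by fact
  show ?thesis
    unfolding verts_collapse ncomp_def
    using assms(2) wf_digraph
    by (intro card_image_kernel) (simp_all add: collapse_vertex_eq_iff joined_class_eq_iff)
qed

text \<open>By the component count for forests, collapsing \<open>F\<close> removes
  \<open>card F\<close> vertices, just as many as edges.\<close>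

lemma has_rank_collapse:
  assumes "fin_digraph G" "F \<subseteq> arcs G" "acyclic_edges G F" "has_rank G r"
  shows "has_rank (collapse G F) r"
proof -
  interpret fin_digraph G by fact
  have "finite F" using assms(2) finite_arcs by (rule finite_subset)
  then have "card (arcs G - F) = card (arcs G) - card F" "card F \<le> card (arcs G)"
    using assms(2) by (auto simp: card_Diff_subset card_mono)
  then show ?thesis
    using assms ncomp_acyclic[OF assms(1-3)] by (simp add: has_rank_def card_verts_collapse)
qed

lemma valence_collapse:
  assumes "wf_digraph G" "F \<subseteq> arcs G" "v \<in> verts G"
  shows "valence (collapse G F) (collapse_vertex G F v) =
    card {x \<in> (arcs G - F) \<times> UNIV. joined G F (end_of G x) v}"
proof -
  have "end_of G x \<in> verts G" if "fst x \<in> arcs G" for x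
    using that assms(1) by (cases x) (auto simp: wf_digraph_def)
  then have "half_edges_at (collapse G F) (collapse_vertex G F v) =
      {x \<in> (arcs G - F) \<times> UNIV. joined G F (end_of G x) v}"
    unfolding half_edges_at_def using assms
    by (auto simp: end_of_collapse collapse_vertex_eq_iff simp del: end_of.simps)
  then show ?thesis by (simp add: valence_def)
qed

text \<open>Each collapse of a non-loop replaces valences \<open>m, n \<ge> 3\<close> by \<open>m + n - 2 \<ge> 4\<close>.\<close>

lemma acyclic_component_valence_ge_3:
  assumes "fin_digraph G" "F \<subseteq> arcs G" "acyclic_edges G F"
    and "\<forall>v\<in>verts G. 3 \<le> valence G v" "v \<in> verts G"
  shows "3 \<le> card {x \<in> (arcs G - F) \<times> UNIV. joined G F (end_of G x) v}"
proof -
  interpret fin_digraph G by fact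
  have "finite F" using assms(2) finite_arcs by (rule finite_subset)
  then show ?thesis using assms(2,3,5)
  proof (induction F arbitrary: v)
    case empty
    have "joined G {} x y \<longleftrightarrow> x = y" for x y
      by (auto simp: joined_def)
    then show ?case
      using assms(4) empty.prems by (simp add: valence_def half_edges_at_def)
  next
    case (insert e F)
    define H where "H v = {x \<in> (arcs G - F) \<times> (UNIV :: bool set). joined G F (end_of G x) v}" for v
    define H' where "H' v = {x \<in> (arcs G - insert e F) \<times> (UNIV :: bool set).
      joined G (insert e F) (end_of G x) v}" for v
    have fin: "finite (H v)" for v
      by (rule finite_subset[of _ "arcs G \<times> UNIV"]) (auto simp: H_def)
    have acyclic: "acyclic_edges G F" and sub: "F \<subseteq> arcs G"
      and e: "tail G e \<in> verts G" "head G e \<in> verts G" "e \<in> arcs G"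
      using insert.prems acyclic_edges_subset by (blast, auto)
    note IH = insert.IH[OF sub acyclic, folded H_def]
    have not: "\<not> joined G F (tail G e) (head G e)"
      using insert.prems insert.hyps by (simp add: acyclic_edges_def)
    have "3 \<le> card (H' v)"
    proof (cases "joined G F v (tail G e) \<or> joined G F v (head G e)")
      case True
      have "joined G (insert e F) x v \<longleftrightarrow> joined G F x (tail G e) \<or> joined G F x (head G e)" for x
        unfolding joined_insert using True by (meson joined_sym joined_trans)
      then have "H' v = (H (tail G e) \<union> H (head G e)) - {(e, False), (e, True)}"
        unfolding H'_def H_def by auto
      moreover have "{(e, False), (e, True)} \<subseteq> H (tail G e) \<union> H (head G e)"
        using e insert.hyps by (auto simp: H_def)
      ultimately have "card (H' v) = card (H (tail G e) \<union> H (head G e)) - 2"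
        by (simp add: card_Diff_subset)
      moreover have "H (tail G e) \<inter> H (head G e) = {}"
        using not unfolding H_def by (auto dest: joined_sym joined_trans)
      ultimately have "card (H' v) = card (H (tail G e)) + card (H (head G e)) - 2"
        by (simp add: card_Un_disjoint fin)
      then show ?thesis
        using IH[OF e(1)] IH[OF e(2)] by simp
    next
      case False
      then have j: "joined G (insert e F) x v \<longleftrightarrow> joined G F x v" for x
        unfolding joined_insert by (meson joined_sym)
      have "(e, b) \<notin> H v" for b
        using False by (cases b) (auto simp: H_def dest: joined_sym)
      then have "H' v = H v"
        unfolding H'_def by (auto simp: j H_def)
      then show ?thesis using IH insert.prems by simp
    qed
    then show ?case by (simp add: H'_def)
  qed
qed

lemma collapse_valence_ge_3:
  assumes "fin_digraph G" "F \<subseteq> arcs G" "acyclic_edges G F"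
    and "\<forall>v\<in>verts G. 3 \<le> valence G v"
  shows "\<forall>v\<in>verts (collapse G F). 3 \<le> valence (collapse G F) v"
  using assms acyclic_component_valence_ge_3[OF assms]
  by (auto simp: verts_collapse valence_collapse fin_digraph_def)

lemma core_edges_collapse_iff:
  assumes "wf_digraph G" "F \<subseteq> arcs G"
  shows "core_edges (collapse G F) S \<longleftrightarrow> S \<noteq> {} \<and> S \<subseteq> arcs G - F \<and>
    (\<forall>e\<in>S. joined G (S - {e} \<union> F) (tail G e) (head G e))"
proof -
  have "joined (collapse G F) (S - {e}) (collapse_vertex G F (tail G e)) (collapse_vertex G F (head G e))
      \<longleftrightarrow> joined G (S - {e} \<union> F) (tail G e) (head G e)" if "S \<subseteq> arcs G - F" "e \<in> S" for e
    using that assms by (intro joined_collapse_iff) (auto simp: wf_digraph_def)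
  then show ?thesis unfolding core_edges_def by auto
qed

section \<open>Filtered graphs under the two parts of the differential\<close>

text \<open>Appending the full edge set to the chain absorbs the requirement that the listed terms
  be proper.\<close>

lemma filtered_graph_iff:
  "Y \<in> filtered_graphs r \<longleftrightarrow>
     fin_digraph (carrier_graph Y) \<and> connected (carrier_graph Y) \<and> has_rank (carrier_graph Y) r \<and>
     (\<forall>v \<in> verts (carrier_graph Y). 3 \<le> valence (carrier_graph Y) v) \<and>
     (\<forall>S \<in> set (filt Y). core_edges (carrier_graph Y) S) \<and>
     sorted_wrt (\<subset>) (filt Y @ [arcs (carrier_graph Y)]) \<and>
     distinct (ord Y) \<and> set (ord Y) = arcs (carrier_graph Y)"
proof -
  have "(\<forall>S\<in>set (filt Y). proper_core (carrier_graph Y) S) \<and> sorted_wrt (\<subset>) (filt Y) \<longleftrightarrow>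
      (\<forall>S\<in>set (filt Y). core_edges (carrier_graph Y) S) \<and>
      sorted_wrt (\<subset>) (filt Y @ [arcs (carrier_graph Y)])" if "fin_digraph (carrier_graph Y)"
    unfolding proper_core_iff[OF that] sorted_wrt_append by simp blast
  then show ?thesis
    unfolding filtered_graphs_def mem_Collect_eq by blast
qed

text \<open>The delicate point is strictness of the new chain. Removing \<open>e\<close> can
  identify two consecutive terms only if they differ by exactly \<open>{e}\<close>, which
  \<open>collapsible\<close> rules out.\<close>

lemma collapse_edge_in_filtered_graphs:
  assumes Y: "Y \<in> filtered_graphs r" and e: "collapsible Y e"
  shows "collapse_edge Y e \<in> filtered_graphs r"
proof -
  let ?G = "carrier_graph Y"
  define L where "L = filt Y @ [arcs ?G]"
  from Y have G: "fin_digraph ?G" "connected ?G" "has_rank ?G r" "\<forall>v\<in>verts ?G. 3 \<le> valence ?G v"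
    and core: "\<forall>S\<in>set (filt Y). core_edges ?G S" and sorted: "sorted_wrt (\<subset>) L"
    and ord: "distinct (ord Y)" "set (ord Y) = arcs ?G"
    by (auto simp: filtered_graph_iff L_def)
  interpret fin_digraph ?G by fact
  have e': "e \<in> arcs ?G" "tail ?G e \<noteq> head ?G e" "{e} \<subseteq> arcs ?G"
    using e by (auto simp: collapsible_def)
  have acyclic: "acyclic_edges ?G {e}"
    using e' by (auto simp: acyclic_edges_def joined_def)
  have gap: "L ! Suc i - L ! i \<noteq> {e}" if "Suc i < length L" for i
  proof -
    \<comment> \<open>Position 0 of the \<open>zip\<close> holds the pair that starts with
      \<open>{}\<close>, hence the shift by one.\<close>
    have "({} # filt Y) ! Suc i = L ! i"
      using that by (simp add: L_def nth_append)
    then have "(L ! i, L ! Suc i) = zip ({} # filt Y) L ! Suc i"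
      using that by (simp add: L_def)
    also have "\<dots> \<in> set (zip ({} # filt Y) L)"
      using that by (intro nth_mem) (simp add: L_def)
    finally show ?thesis
      using e unfolding collapsible_def L_def by blast
  qed
  have "sorted_wrt (\<subset>) (map (\<lambda>S. S - {e}) L)"
    unfolding sorted_wrt_iff_nth_less
  proof (intro allI impI)
    fix i j assume "i < j" "j < length (map (\<lambda>S. S - {e}) L)"
    then have ij: "i < j" "j < length L" by auto
    then have "L ! i \<subset> L ! Suc i"
      using sorted by (simp add: sorted_wrt_iff_nth_less)
    moreover have "L ! Suc i \<subseteq> L ! j"
      using sorted ij by (cases "j = Suc i") (auto simp: sorted_wrt_iff_nth_less psubset_eq)
    moreover have "L ! Suc i - L ! i \<noteq> {e}"
      using gap ij by simp
    ultimately have "L ! i - {e} \<subset> L ! j - {e}" by blast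
    then show "map (\<lambda>S. S - {e}) L ! i \<subset> map (\<lambda>S. S - {e}) L ! j"
      using ij by simp
  qed
  then have "sorted_wrt (\<subset>) (map (\<lambda>S. S - {e}) (filt Y) @ [arcs ?G - {e}])"
    by (simp add: L_def)
  moreover have "core_edges (collapse ?G {e}) (S - {e})" if "S \<in> set (filt Y)" for S
  proof -
    have S: "S \<noteq> {}" "S \<subseteq> arcs ?G" "\<And>f. f \<in> S \<Longrightarrow> joined ?G (S - {f}) (tail ?G f) (head ?G f)"
      using core that by (auto simp: core_edges_def)
    \<comment> \<open>If \<open>e\<close> were the only edge of a core set, it would have to be a
      loop.\<close>
    have "S \<noteq> {e}"
      using S(3)[of e] e'(2) by (auto simp: joined_def)
    moreover have "joined ?G (S - {e} - {f} \<union> {e}) (tail ?G f) (head ?G f)" if "f \<in> S - {e}" for f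
      using that by (intro joined_mono[OF S(3)[of f]]) auto
    ultimately show ?thesis
      using S e' by (subst core_edges_collapse_iff) (auto intro: wf_digraph)
  qed
  ultimately show ?thesis
    using fin_digraph_collapse[OF G(1)] connected_collapse[OF wf_digraph e'(3) G(2)]
      has_rank_collapse[OF G(1) e'(3) acyclic G(3)] collapse_valence_ge_3[OF G(1) e'(3) acyclic G(4)] ord
    by (auto simp: filtered_graph_iff collapse_edge_def)
qed

lemma ncomp_eq_1:
  assumes "verts G \<noteq> {}" "\<And>u v. u \<in> verts G \<Longrightarrow> v \<in> verts G \<Longrightarrow> joined G S u v"
  shows "ncomp G S = 1"
proof -
  have "(\<lambda>v. {u \<in> verts G. joined G S v u}) ` verts G = (\<lambda>v. verts G) ` verts G"
    by (rule image_cong) (use assms(2) in auto)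
  then show ?thesis
    using assms(1) by (simp add: ncomp_def image_constant_conv)
qed

lemma betti_arcs:
  assumes "fin_digraph G" "connected G" "has_rank G r"
  shows "betti G (arcs G) = int r"
proof -
  interpret fin_digraph G by fact
  have "verts G \<noteq> {}" and j: "\<And>u v. u \<in> verts G \<Longrightarrow> v \<in> verts G \<Longrightarrow> joined G (arcs G) u v"
    using assms(2) by (auto simp: connected_iff[OF wf_digraph])
  then have "ncomp G (arcs G) = 1"
    by (rule ncomp_eq_1)
  then show ?thesis
    using assms(3) by (simp add: betti_def has_rank_def)
qed

text \<open>Betti numbers increase strictly along a chain of core subgraphs, so a chain of \<open>r\<close> of them
  in a graph of rank \<open>r\<close> cannot be refined.\<close>

lemma insertable_empty:
  assumes Y: "Y \<in> filtered_graphs r" and "length (filt Y) + 1 = r"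
    and core: "core_edges (carrier_graph Y) (arcs (carrier_graph Y))"
  shows "insertable Y = {}"
proof (rule ccontr)
  let ?G = "carrier_graph Y"
  assume "insertable Y \<noteq> {}"
  then obtain C where C: "proper_core ?G C" and comp: "\<And>S. S \<in> set (filt Y) \<Longrightarrow> S \<subset> C \<or> C \<subset> S"
    by (auto simp: insertable_def)
  from Y have G: "fin_digraph ?G" "connected ?G" "has_rank ?G r"
    and filt: "\<forall>S\<in>set (filt Y). core_edges ?G S" "sorted_wrt (\<subset>) (filt Y @ [arcs ?G])"
    by (auto simp: filtered_graph_iff)
  have C': "core_edges ?G C" "C \<subset> arcs ?G"
    using C G(1) by (auto simp: proper_core_iff)
  \<comment> \<open>With \<open>C\<close> inserted and the full edge set appended, this chain has
    \<open>r + 1\<close> terms, one more than the Betti number \<open>r\<close> permits.\<close>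
  define L where "L = filter (\<lambda>S. S \<subset> C) (filt Y) @ C # filter (\<lambda>S. C \<subset> S) (filt Y) @ [arcs ?G]"
  have "sorted_wrt (\<subset>) L"
    using filt(2) C' unfolding L_def by (auto simp: sorted_wrt_append sorted_wrt_filter)
  moreover have "\<forall>S\<in>set L. core_edges ?G S"
    using filt(1) C' core by (auto simp: L_def)
  ultimately have "int (length L) \<le> int r"
    using core_chain_length[OF G(1)] betti_arcs[OF G] by metis
  moreover have "filter (\<lambda>S. C \<subset> S) (filt Y) = filter (\<lambda>S. \<not> S \<subset> C) (filt Y)"
    using comp by (intro filter_cong) auto
  then have "length (filter (\<lambda>S. S \<subset> C) (filt Y)) + length (filter (\<lambda>S. C \<subset> S) (filt Y)) = length (filt Y)"
    by (simp add: sum_length_filter_compl)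
  ultimately show False
    using assms(2) by (simp add: L_def)
qed

section \<open>The blown-up graphs\<close>

lemma tail_blowup [simp]:
    "tail (blowup X A \<iota>) (Side s i) = Corner s i"
    "tail (blowup X A \<iota>) (Old e) = attach X A \<iota> (e, False)"
  and head_blowup [simp]:
    "head (blowup X A \<iota>) (Side s i) = Corner s (Suc i mod valence X s)"
    "head (blowup X A \<iota>) (Old e) = attach X A \<iota> (e, True)"
  and verts_blowup: "verts (blowup X A \<iota>) =
    Plain ` (verts X - A) \<union> {Corner s i | s i. s \<in> A \<and> i < valence X s}"
  and arcs_blowup: "arcs (blowup X A \<iota>) = (\<Union>s \<in> A. set (sides X s)) \<union> Old ` arcs X"
  by (simp_all add: blowup_def)

lemma end_of_Old [simp]: "end_of (blowup X A \<iota>) (Old e, b) = attach X A \<iota> (e, b)"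
  by (cases b) auto

lemma set_sides: "set (sides X s) = Side s ` {..<valence X s}"
  by (auto simp: sides_def)

lemma inj_Old: "inj_on Old N"
  by (auto simp: inj_on_def)

text \<open>The remaining sides form a path the other way round the polygon: from the successor of
  corner \<open>i\<close>, fewer than \<open>valence X s\<close> steps never use side
  \<open>i\<close>, and one less than the valence leads back to corner \<open>i\<close>.\<close>

lemma joined_other_sides:
  assumes "i < valence X s"
  shows "joined (blowup X A \<iota>) (set (sides X s) - {Side s i}) (Corner s i) (Corner s (Suc i mod valence X s))"
proof -
  let ?n = "valence X s" and ?G = "blowup X A \<iota>" and ?S = "set (sides X s) - {Side s i}"
  have "joined ?G ?S (Corner s (Suc i mod ?n)) (Corner s ((Suc i + k) mod ?n))" if "k < ?n" for k
    using that
  proof (induction k)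
    case (Suc k)
    let ?j = "(Suc i + k) mod ?n"
    have "?j \<noteq> i"
    proof
      assume "?j = i"
      then have "(i + Suc k) mod ?n = i mod ?n"
        using assms by simp
      then have "?n dvd Suc k"
        using mod_eq_dvd_iff_nat[of i "i + Suc k" ?n] by simp
      then show False using Suc.prems by (auto dest: dvd_imp_le)
    qed
    then have "Side s ?j \<in> ?S"
      using assms by (simp add: set_sides)
    then have "joined ?G ?S (Corner s ?j) (Corner s (Suc ?j mod ?n))"
      using joined_edge[of "Side s ?j" ?S ?G] by simp
    also have "Suc ?j mod ?n = (Suc i + Suc k) mod ?n"
      by (simp add: mod_Suc_eq)
    finally show ?case
      using Suc joined_trans by fastforce
  qed simp
  from this[of "?n - 1"] have "joined ?G ?S (Corner s (Suc i mod ?n)) (Corner s i)"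
    using assms by simp
  then show ?thesis by (rule joined_sym)
qed

lemma joined_sides:
  assumes "i < valence X s" "j < valence X s"
  shows "joined (blowup X A \<iota>) (set (sides X s)) (Corner s i) (Corner s j)"
proof -
  let ?G = "blowup X A \<iota>" and ?S = "set (sides X s)"
  have "joined ?G ?S (Corner s 0) (Corner s i)" if "i < valence X s" for i
    using that
  proof (induction i)
    case (Suc i)
    then have "joined ?G ?S (Corner s i) (Corner s (Suc i))"
      using joined_edge[of "Side s i" ?S ?G] by (simp add: set_sides)
    then show ?case using Suc joined_trans by fastforce
  qed simp
  then show ?thesis using assms joined_sym joined_trans by metis
qed

section \<open>Blown-up graphs over a fixed tree and fixed orderings\<close>

locale AB_data =
  fixes X :: "('v, 'e) pre_digraph" and A :: "'v set" and T :: "'e set"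
    and o1 :: "'v list" and o2 :: "'e list"
  assumes AB: "AB_graph X A" and tree: "maximal_tree X T"
    and o1: "distinct o1" "set o1 = A"
    and o2: "distinct o2" "set o2 = arcs X - T"
begin

sublocale fin_digraph X
  using AB by (simp add: AB_graph_def)

lemma valence_ge_3: "v \<in> verts X \<Longrightarrow> 3 \<le> valence X v"
  and A_subset: "A \<subseteq> verts X"
  and T_subset: "T \<subseteq> arcs X"
  using AB tree by (auto simp: AB_graph_def maximal_tree_def)

lemma valence_A_ge_3: "s \<in> A \<Longrightarrow> 3 \<le> valence X s"
  using A_subset valence_ge_3 by blast

lemma finite_A: "finite A"
  using A_subset finite_verts by (rule finite_subset)

lemma verts_nonempty: "verts X \<noteq> {}"
  and joined_T: "u \<in> verts X \<Longrightarrow> v \<in> verts X \<Longrightarrow> joined X T u v"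
proof -
  have "wf_digraph (X\<lparr>arcs := T\<rparr>)"
    using T_subset by (auto simp: wf_digraph_def)
  from connected_iff[OF this] tree
  show "verts X \<noteq> {}" "u \<in> verts X \<Longrightarrow> v \<in> verts X \<Longrightarrow> joined X T u v"
    by (auto simp: maximal_tree_def)
qed

lemma acyclic_T: "acyclic_edges X T"
  using tree by (intro acyclic_edges_if_no_circuit) (simp add: maximal_tree_def)

lemma card_T: "card T + 1 = card (verts X)"
  using ncomp_acyclic[OF fin_digraph T_subset acyclic_T] ncomp_eq_1[OF verts_nonempty joined_T] by simp

text \<open>If the tree contained all edges, its only component would have no outgoing half-edges,
  against the bound of 3. Consequently the union of all polygons is a proper term of the
  filtration.\<close>

lemma o2_nonempty: "o2 \<noteq> []"
proof
  assume "o2 = []"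
  then have "T = arcs X"
    using o2 T_subset by auto
  moreover obtain v where v: "v \<in> verts X"
    using verts_nonempty by blast
  ultimately show False
    using acyclic_component_valence_ge_3[OF fin_digraph T_subset acyclic_T _ v] valence_ge_3 by simp
qed

definition attaching_families :: "('v \<Rightarrow> 'e \<times> bool \<Rightarrow> nat) set" where
  "attaching_families = (\<Pi>\<^sub>E s \<in> A. attachings X s)"

lemma attaching_less:
  assumes "\<iota> \<in> attaching_families" "e \<in> arcs X" "end_of X (e, b) \<in> A"
  shows "\<iota> (end_of X (e, b)) (e, b) < valence X (end_of X (e, b))"
proof -
  let ?s = "end_of X (e, b)"
  have "bij_betw (\<iota> ?s) (half_edges_at X ?s) {..<valence X ?s}"
    using assms by (auto simp: attaching_families_def attachings_def PiE_def Pi_def simp del: end_of.simps)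
  moreover have "(e, b) \<in> half_edges_at X ?s"
    using assms by (simp add: half_edges_at_def del: end_of.simps)
  ultimately show ?thesis
    by (meson bij_betwE lessThan_iff)
qed

lemma end_of_in_verts: "e \<in> arcs X \<Longrightarrow> end_of X (e, b) \<in> verts X"
  by simp

lemma attach_in_verts:
  assumes "\<iota> \<in> attaching_families" "e \<in> arcs X"
  shows "attach X A \<iota> (e, b) \<in> verts (blowup X A \<iota>)"
  using attaching_less[OF assms] end_of_in_verts[OF assms(2), of b]
  by (auto simp: attach_def verts_blowup simp del: end_of.simps)

lemma corners_eq: "{Corner s i | s i. s \<in> A \<and> i < valence X s} = (\<Union>s\<in>A. Corner s ` {..<valence X s})"
  by auto

lemma fin_digraph_blowup:
  assumes "\<iota> \<in> attaching_families"
  shows "fin_digraph (blowup X A \<iota>)"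
proof unfold_locales
  show "finite (verts (blowup X A \<iota>))"
    using finite_A by (simp add: verts_blowup corners_eq)
  show "finite (arcs (blowup X A \<iota>))"
    using finite_A by (simp add: arcs_blowup)
next
  fix d assume "d \<in> arcs (blowup X A \<iota>)"
  then show "tail (blowup X A \<iota>) d \<in> verts (blowup X A \<iota>)" "head (blowup X A \<iota>) d \<in> verts (blowup X A \<iota>)"
    using attach_in_verts[OF assms] valence_A_ge_3
    by (fastforce simp: arcs_blowup set_sides verts_blowup)+
qed

text \<open>A plain vertex keeps its half-edges. A corner meets two sides and, because the attaching
  map is bijective, a half-edge of \<open>X\<close>.\<close>

lemma valence_blowup_ge_3:
  assumes \<iota>: "\<iota> \<in> attaching_families" and u: "u \<in> verts (blowup X A \<iota>)"
  shows "3 \<le> valence (blowup X A \<iota>) u"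
proof -
  let ?G = "blowup X A \<iota>"
  interpret Y: fin_digraph ?G by (rule fin_digraph_blowup[OF \<iota>])
  have fin: "finite (half_edges_at ?G u)"
    by (rule finite_subset[of _ "arcs ?G \<times> UNIV"]) (auto simp: half_edges_at_def)
  from u consider (plain) v where "v \<in> verts X" "v \<notin> A" "u = Plain v"
    | (corner) s i where "s \<in> A" "i < valence X s" "u = Corner s i"
    by (auto simp: verts_blowup)
  then show ?thesis
  proof cases
    case plain
    have "map_prod Old id ` half_edges_at X v \<subseteq> half_edges_at ?G u"
      using plain by (auto simp: half_edges_at_def arcs_blowup attach_def simp del: end_of.simps simp: end_of_Old)
    then have "card (map_prod Old id ` half_edges_at X v :: (('v, 'e) blowup_edge \<times> bool) set) \<le> card (half_edges_at ?G u)"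
      using fin by (intro card_mono)
    moreover have "card (map_prod Old id ` half_edges_at X v :: (('v, 'e) blowup_edge \<times> bool) set) = valence X v"
      unfolding valence_def by (rule card_image) (auto simp: inj_on_def)
    ultimately show ?thesis
      using valence_ge_3 plain by (fastforce simp: valence_def)
  next
    case corner
    have "bij_betw (\<iota> s) (half_edges_at X s) {..<valence X s}"
      using \<iota> corner by (auto simp: attaching_families_def attachings_def PiE_def Pi_def)
    then obtain e b where eb: "(e, b) \<in> half_edges_at X s" "\<iota> s (e, b) = i"
      using corner by (metis bij_betw_imp_surj_on imageE lessThan_iff surj_pair)
    \<comment> \<open>The cyclic predecessor of \<open>i\<close>: the side that ends at corner
      \<open>i\<close>.\<close>
    define j where "j = (if i = 0 then valence X s - 1 else i - 1)"
    have j: "j < valence X s" "Suc j mod valence X s = i"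
      using corner valence_A_ge_3[of s] by (auto simp: j_def)
    have "{(Side s i, False), (Side s j, True), (Old e, b)} \<subseteq> half_edges_at ?G u"
      using corner eb j by (auto simp: half_edges_at_def arcs_blowup set_sides attach_def simp del: end_of.simps
        simp: end_of_Old end_of.simps[of ?G "Side _ _"])
    then have "card {(Side s i, False), (Side s j, True), (Old e, b)} \<le> card (half_edges_at ?G u)"
      using fin by (intro card_mono)
    then show ?thesis by (simp add: valence_def)
  qed
qed

text \<open>A polygon with \<open>n\<close> sides in place of a vertex adds \<open>n\<close> edges
  and \<open>n - 1\<close> vertices, so each type A vertex raises by one the rank
  \<open>length o2\<close> of \<open>X\<close>.\<close>

lemma has_rank_blowup: "has_rank (blowup X A \<iota>) (length o1 + length o2)"
proof -
  have corners: "card (\<Union>s\<in>A. Corner s ` {..<valence X s}) = (\<Sum>s\<in>A. valence X s)"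
    using finite_A by (subst card_UN_disjoint) (auto simp: card_image inj_on_def)
  have all_sides: "card (\<Union>s\<in>A. Side s ` {..<valence X s}) = (\<Sum>s\<in>A. valence X s)"
    using finite_A by (subst card_UN_disjoint) (auto simp: card_image inj_on_def)
  have "card (verts (blowup X A \<iota>)) = card (Plain ` (verts X - A)) + (\<Sum>s\<in>A. valence X s)"
    unfolding verts_blowup corners_eq using finite_A
    by (subst card_Un_disjoint) (auto simp: corners)
  also have "card (Plain ` (verts X - A)) = card (verts X) - card A"
    using A_subset finite_A by (subst card_image) (auto simp: inj_on_def card_Diff_subset)
  finally have V: "card (verts (blowup X A \<iota>)) = card (verts X) - card A + (\<Sum>s\<in>A. valence X s)" .
  have E: "card (arcs (blowup X A \<iota>)) = (\<Sum>s\<in>A. valence X s) + card (arcs X)"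
    unfolding arcs_blowup set_sides using finite_A
    by (subst card_Un_disjoint) (auto simp: all_sides card_image inj_Old)
  have "card A = length o1" "card (arcs X - T) = length o2"
    using o1 o2 distinct_card by metis+
  moreover have "card (arcs X - T) = card (arcs X) - card T" "card T \<le> card (arcs X)"
    using T_subset finite_subset[OF T_subset finite_arcs] by (auto simp: card_Diff_subset card_mono)
  moreover have "card A \<le> card (verts X)"
    using A_subset by (simp add: card_mono)
  ultimately show ?thesis
    using V E card_T by (simp add: has_rank_def)
qed

text \<open>Contracting every polygon recovers \<open>X\<close>.\<close>

fun base :: "'v blowup_vertex \<Rightarrow> 'v" where
  "base (Plain v) = v"
| "base (Corner s i) = s"

lemma base_attach [simp]: "base (attach X A \<iota> x) = end_of X x"
  by (simp add: attach_def)

text \<open>A connection bypassing a tree edge in the blown-up graph would project along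
  \<open>base\<close> to one in \<open>X\<close>.\<close>

lemma acyclic_blowup: "acyclic_edges (blowup X A \<iota>) (Old ` T)"
  unfolding acyclic_edges_def
proof (intro ballI notI)
  let ?G = "blowup X A \<iota>"
  fix d assume "d \<in> Old ` T" and j: "joined ?G (Old ` T - {d}) (tail ?G d) (head ?G d)"
  then obtain e where e: "e \<in> T" "d = Old e" by blast
  have "joined X (T - {e}) (base (tail ?G d)) (base (head ?G d))"
    by (rule joined_map[OF j]) (auto simp: e intro: joined_edge)
  then show False
    using acyclic_T e by (auto simp: acyclic_edges_def)
qed

lemma joined_spanning:
  assumes \<iota>: "\<iota> \<in> attaching_families" and uv: "u \<in> verts (blowup X A \<iota>)" "v \<in> verts (blowup X A \<iota>)"
  shows "joined (blowup X A \<iota>) ((\<Union>s\<in>A. set (sides X s)) \<union> Old ` T) u v" (is "joined ?G ?S u v")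
proof -
  \<comment> \<open>A section of \<open>base\<close>. It lifts connections in \<open>T\<close>,
    since the corners of one polygon are joined to each other by its sides.\<close>
  define rep where "rep v = (if v \<in> A then Corner v 0 else Plain v)" for v
  have rep: "joined ?G ?S (rep (base w)) w" if w: "w \<in> verts ?G" for w
  proof -
    from w consider v where "v \<notin> A" "w = Plain v" | s i where "s \<in> A" "i < valence X s" "w = Corner s i"
      by (auto simp: verts_blowup)
    then show ?thesis
    proof cases
      case 2
      have "joined ?G (set (sides X s)) (Corner s 0) (Corner s i)"
        using 2 by (intro joined_sides) auto
      then show ?thesis
        using 2 by (auto simp: rep_def intro: joined_mono)
    qed (simp add: rep_def)
  qed
  have "joined X T (base u) (base v)"
    using uv A_subset by (intro joined_T) (auto simp: verts_blowup)
  then have "joined ?G ?S (rep (base u)) (rep (base v))"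
  proof (rule joined_map)
    fix e assume e: "e \<in> T"
    then have "e \<in> arcs X" using T_subset by blast
    from attach_in_verts[OF \<iota> this] have "joined ?G ?S (rep (tail X e)) (attach X A \<iota> (e, False))"
      "joined ?G ?S (rep (head X e)) (attach X A \<iota> (e, True))"
      using rep[of "attach X A \<iota> (e, False)"] rep[of "attach X A \<iota> (e, True)"] by simp_all
    moreover have "joined ?G ?S (attach X A \<iota> (e, False)) (attach X A \<iota> (e, True))"
      using joined_edge[of "Old e" ?S ?G] e by simp
    ultimately show "joined ?G ?S (rep (tail X e)) (rep (head X e))"
      by (meson joined_sym joined_trans)
  qed
  then show ?thesis
    using rep uv by (meson joined_sym joined_trans)
qed

section \<open>The filtration by core graphs\<close>

abbreviation Y :: "('v \<Rightarrow> 'e \<times> bool \<Rightarrow> nat) \<Rightarrow> ('v blowup_vertex, ('v, 'e) blowup_edge) filtered_graph" where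
  "Y \<equiv> Y_graph X A T o1 o2"

text \<open>Terms of the filtration of \<open>Y\<close>; the truncated subtraction lets one formula cover the polygons and
  the edges \<open>e\<^sub>j\<close>.\<close>

definition level :: "nat \<Rightarrow> ('v, 'e) blowup_edge set" where
  "level m = (\<Union>s \<in> set (take m o1). set (sides X s)) \<union> Old ` set (take (m - length o1) o2)"

lemma carrier_Y [simp]: "carrier_graph (Y \<iota>) = collapse (blowup X A \<iota>) (Old ` T)"
  and ord_Y: "ord (Y \<iota>) = concat (map (sides X) o1) @ map Old o2"
  by (simp_all add: Y_graph_def)

lemma Old_T_subset: "Old ` T \<subseteq> arcs (blowup X A \<iota>)"
  using T_subset by (auto simp: arcs_blowup)

lemma arcs_Y: "arcs (collapse (blowup X A \<iota>) (Old ` T)) = (\<Union>s\<in>A. set (sides X s)) \<union> Old ` (arcs X - T)"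
  by (auto simp: arcs_blowup set_sides)

lemma level_0: "level 0 = {}"
  by (simp add: level_def)

lemma level_top: "arcs (collapse (blowup X A \<iota>) (Old ` T)) = level (length o1 + length o2)"
  unfolding arcs_Y by (simp add: level_def o1 o2)

lemma level_Suc_sides:
  assumes "m < length o1"
  shows "level (Suc m) = set (sides X (o1 ! m)) \<union> level m" "set (sides X (o1 ! m)) \<inter> level m = {}"
proof -
  show "level (Suc m) = set (sides X (o1 ! m)) \<union> level m"
    using assms by (auto simp: level_def take_Suc_conv_app_nth)
  have "o1 ! m \<notin> set (take m o1)"
    using assms o1(1) by (auto simp: in_set_conv_nth nth_eq_iff_index_eq)
  then show "set (sides X (o1 ! m)) \<inter> level m = {}"
    using assms by (auto simp: level_def set_sides)
qed

lemma level_Suc_Old: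
  assumes "j < length o2"
  shows "level (Suc (length o1 + j)) = insert (Old (o2 ! j)) (level (length o1 + j))"
    "Old (o2 ! j) \<notin> level (length o1 + j)"
proof -
  show "level (Suc (length o1 + j)) = insert (Old (o2 ! j)) (level (length o1 + j))"
    using assms by (auto simp: level_def take_Suc_conv_app_nth Suc_diff_le)
  have "o2 ! j \<notin> set (take j o2)"
    using assms o2(1) by (auto simp: in_set_conv_nth nth_eq_iff_index_eq)
  then show "Old (o2 ! j) \<notin> level (length o1 + j)"
    using assms by (auto simp: level_def set_sides)
qed

lemma level_psubset_Suc:
  assumes "m < length o1 + length o2"
  shows "level m \<subset> level (Suc m)"
proof (cases "m < length o1")
  case True
  then have "o1 ! m \<in> A" using o1 by auto
  then have "Side (o1 ! m) 0 \<in> set (sides X (o1 ! m))"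
    using valence_A_ge_3[of "o1 ! m"] by (auto simp: set_sides)
  then show ?thesis
    using level_Suc_sides[OF True] by blast
next
  case False
  then obtain j where "m = length o1 + j" "j < length o2"
    using assms that[of "m - length o1"] by auto
  then show ?thesis
    using level_Suc_Old[of j] by auto
qed

lemma filt_Y: "filt (Y \<iota>) = map level [1..<length o1 + length o2]"
proof -
  have "map (\<lambda>j. j + length o1) [1..<length o2] = [length o1 + 1..<length o1 + length o2]"
    by (rule nth_equalityI) auto
  then have "[1..<length o1 + length o2] = [1..<length o1 + 1] @ map (\<lambda>j. j + length o1) [1..<length o2]"
    using o2_nonempty upt_add_eq_append[of 1 "length o1 + 1" "length o2 - 1"]
    by (simp add: Suc_le_eq del: upt_Suc)
  then show ?thesis
    by (simp add: Y_graph_def level_def o1 del: upt_Suc)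
qed

text \<open>A side is bypassed the other way round its polygon. An edge outside the tree occurs only
  once all polygons are present, and is bypassed through them and the tree, whose edges are free
  after the collapse.\<close>

lemma core_level:
  assumes \<iota>: "\<iota> \<in> attaching_families" and m: "0 < m" "m \<le> length o1 + length o2"
  shows "core_edges (collapse (blowup X A \<iota>) (Old ` T)) (level m)"
proof -
  let ?G = "blowup X A \<iota>"
  interpret Y: fin_digraph ?G by (rule fin_digraph_blowup[OF \<iota>])
  have sub: "level m \<subseteq> arcs ?G - Old ` T"
    using set_take_subset[of m o1] set_take_subset[of "m - length o1" o2] o1 o2
    by (auto simp: level_def arcs_blowup set_sides)
  have "level (m - 1) \<subset> level m"
    using level_psubset_Suc[of "m - 1"] m by simp
  then have "level m \<noteq> {}" by blast
  moreover have "joined ?G (level m - {d} \<union> Old ` T) (tail ?G d) (head ?G d)" if d: "d \<in> level m" for d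
  proof (cases d)
    case (Side s i)
    then have s: "s \<in> set (take m o1)" "i < valence X s"
      using d by (auto simp: level_def set_sides)
    then have "set (sides X s) \<subseteq> level m"
      by (auto simp: level_def)
    then have "set (sides X s) - {d} \<subseteq> level m - {d} \<union> Old ` T"
      by blast
    then show ?thesis
      using joined_mono[OF joined_other_sides[OF s(2)]] Side by simp
  next
    case (Old e)
    then have "e \<in> set (take (m - length o1) o2)"
      using d by (auto simp: level_def set_sides)
    then have "length o1 < m"
      by (cases "length o1 < m") auto
    then have "(\<Union>s\<in>A. set (sides X s)) \<union> Old ` T \<subseteq> level m - {d} \<union> Old ` T"
      using o1 Old by (auto simp: level_def set_sides)
    moreover have "tail ?G d \<in> verts ?G" "head ?G d \<in> verts ?G"
      using d sub by auto
    ultimately show ?thesis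
      using joined_mono[OF joined_spanning[OF \<iota>]] by blast
  qed
  ultimately show ?thesis
    using sub by (subst core_edges_collapse_iff[OF Y.wf_digraph Old_T_subset]) auto
qed

lemma Y_in_filtered_graphs:
  assumes \<iota>: "\<iota> \<in> attaching_families"
  shows "Y \<iota> \<in> filtered_graphs (length o1 + length o2)"
proof -
  let ?G = "blowup X A \<iota>" and ?k = "length o1 + length o2"
  interpret Y: fin_digraph ?G by (rule fin_digraph_blowup[OF \<iota>])
  have "verts ?G \<noteq> {}"
    using verts_nonempty valence_A_ge_3 by (fastforce simp: verts_blowup)
  moreover have "joined ?G (arcs ?G) u v" if "u \<in> verts ?G" "v \<in> verts ?G" for u v
    using joined_spanning[OF \<iota> that] by (rule joined_mono) (use T_subset in \<open>auto simp: arcs_blowup\<close>)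
  ultimately have con: "connected ?G"
    by (simp add: connected_iff[OF Y.wf_digraph])
  have "filt (Y \<iota>) @ [level ?k] = map level [1..<Suc ?k]"
    using o2_nonempty by (simp add: filt_Y Suc_le_eq)
  moreover have "sorted_wrt (\<subset>) (map level [1..<Suc ?k])"
    using level_psubset_Suc by (subst sorted_wrt_iff_nth_Suc_transp) (auto simp del: upt_Suc intro!: transpI)
  ultimately have "sorted_wrt (\<subset>) (filt (Y \<iota>) @ [arcs (carrier_graph (Y \<iota>))])"
    by (simp add: level_top del: arcs_collapse)
  moreover have "distinct (ord (Y \<iota>))"
  proof -
    have "s = t" if "s \<in> A" "sides X s = sides X t" for s t
    proof -
      have "Side s 0 \<in> set (sides X s)"
        using valence_A_ge_3[OF that(1)] by (auto simp: set_sides)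
      then show ?thesis using that(2) by (auto simp: set_sides)
    qed
    then have "distinct (concat (map (sides X) o1))"
      using o1 by (intro distinct_concat) (auto simp: distinct_map inj_on_def sides_def)
    then show ?thesis
      unfolding ord_Y using o2 by (auto simp: distinct_map inj_on_def set_sides)
  qed
  moreover have "set (ord (Y \<iota>)) = arcs (collapse ?G (Old ` T))"
    unfolding ord_Y arcs_Y using o1 o2 by auto
  moreover have "core_edges (collapse ?G (Old ` T)) S" if "S \<in> set (filt (Y \<iota>))" for S
    using that core_level[OF \<iota>] by (auto simp: filt_Y)
  ultimately show ?thesis
    unfolding filtered_graph_iff carrier_Y
    using fin_digraph_collapse[OF Y.fin_digraph] connected_collapse[OF Y.wf_digraph Old_T_subset con]
      has_rank_collapse[OF Y.fin_digraph Old_T_subset acyclic_blowup has_rank_blowup]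
      collapse_valence_ge_3[OF Y.fin_digraph Old_T_subset acyclic_blowup] valence_blowup_ge_3[OF \<iota>]
    by blast
qed

lemma dF_gen_Y:
  assumes "\<iota> \<in> attaching_families"
  shows "dF_gen (Y \<iota>) = 0"
proof -
  have "length (filt (Y \<iota>)) + 1 = length o1 + length o2"
    using o2_nonempty by (simp add: filt_Y)
  moreover have "core_edges (carrier_graph (Y \<iota>)) (arcs (carrier_graph (Y \<iota>)))"
    using core_level[OF assms, of "length o1 + length o2"] o2_nonempty
    by (simp add: level_top del: arcs_collapse)
  ultimately have "insertable (Y \<iota>) = {}"
    using Y_in_filtered_graphs[OF assms] by (intro insertable_empty)
  then show ?thesis by (simp add: dF_gen_def)
qed

lemma not_collapsible_Old: "\<not> collapsible (Y \<iota>) (Old e)"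
proof
  let ?k = "length o1 + length o2"
  assume coll: "collapsible (Y \<iota>) (Old e)"
  then have "e \<in> set o2"
    using o2 by (auto simp: collapsible_def arcs_blowup set_sides)
  then obtain j where j: "j < length o2" "e = o2 ! j"
    by (auto simp: in_set_conv_nth)
  have "{} # filt (Y \<iota>) = map level [0..<?k]"
    using o2_nonempty by (simp add: filt_Y level_0 upt_conv_Cons)
  moreover have "filt (Y \<iota>) @ [arcs (carrier_graph (Y \<iota>))] = map level [1..<Suc ?k]"
    using o2_nonempty by (simp add: filt_Y level_top Suc_le_eq del: arcs_collapse)
  ultimately have "set (zip ({} # filt (Y \<iota>)) (filt (Y \<iota>) @ [arcs (carrier_graph (Y \<iota>))]))
      = set (zip (map level [0..<?k]) (map level [1..<Suc ?k]))"
    by simp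
  moreover have "(level (length o1 + j), level (Suc (length o1 + j))) \<in> \<dots>"
    using j by (auto simp: set_zip simp del: upt_Suc intro!: exI[of _ "length o1 + j"])
  ultimately have "level (Suc (length o1 + j)) - level (length o1 + j) \<noteq> {Old e}"
    using coll unfolding collapsible_def by blast
  then show False
    using level_Suc_Old[OF j(1)] j(2) by auto
qed

end

section \<open>Linear algebra of chains\<close>

text \<open>Coefficients may cancel in a sum of chains; additivity is therefore read off over a
  common finite set containing both supports.\<close>

lemma boundary_superset:
  assumes "finite K" "Poly_Mapping.keys c \<subseteq> K"
  shows "boundary c = (\<Sum>Y \<in> K. qscale (Poly_Mapping.lookup c Y) (dE_gen Y + dF_gen Y))"
  unfolding boundary_def using assms
  by (intro sum.mono_neutral_left) (auto simp: in_keys_iff)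

lemma boundary_add: "boundary (c + c') = boundary c + boundary c'"
proof -
  let ?K = "Poly_Mapping.keys c \<union> Poly_Mapping.keys c'"
  have "boundary (c + c') = (\<Sum>Y \<in> ?K. qscale (Poly_Mapping.lookup (c + c') Y) (dE_gen Y + dF_gen Y))"
    using Poly_Mapping.keys_add[of c c'] by (intro boundary_superset) auto
  also have "\<dots> = boundary c + boundary c'"
    by (simp add: boundary_superset[of ?K c] boundary_superset[of ?K c'] lookup_add
        chain.scale_left_distrib sum.distrib)
  finally show ?thesis .
qed

lemma boundary_single: "boundary (Poly_Mapping.single Y a) = qscale a (dE_gen Y + dF_gen Y)"
  by (subst boundary_superset[of "{Y}"]) auto

lemma boundary_sum_single:
  "boundary (\<Sum>i\<in>I. Poly_Mapping.single (Y i) (a i)) = (\<Sum>i\<in>I. qscale (a i) (dE_gen (Y i) + dF_gen (Y i)))"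
proof (induction I rule: infinite_finite_induct)
  case (insert i I)
  then show ?case by (simp add: boundary_add boundary_single)
qed (simp_all add: boundary_def)

lemma zero_in_chains: "0 \<in> chains r"
  by (simp add: chains_def)

lemma sum_in_chains: "(\<And>i. i \<in> I \<Longrightarrow> f i \<in> chains r) \<Longrightarrow> sum f I \<in> chains r"
proof (induction I rule: infinite_finite_induct)
  case (insert i I)
  then show ?case
    using Poly_Mapping.keys_add[of "f i" "sum f I"] by (auto simp: chains_def)
qed (auto simp: zero_in_chains)

lemma qscale_in_chains: "c \<in> chains r \<Longrightarrow> qscale a c \<in> chains r"
  by (auto simp: chains_def in_keys_iff lookup_qscale)

lemma single_in_chains: "Y \<in> filtered_graphs r \<Longrightarrow> Poly_Mapping.single Y a \<in> chains r"
  by (simp add: chains_def)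

lemma qscale_single: "qscale a (Poly_Mapping.single Y b) = Poly_Mapping.single Y (a * b)"
  by (auto intro!: poly_mapping_eqI simp: lookup_qscale lookup_single when_def)

lemma B_class_eq_zero:
  assumes "x \<in> chains r" "x \<in> chain.span (relations r)"
  shows "B_class r x = B_class r 0"
proof -
  have "x - y \<in> chain.span (relations r) \<longleftrightarrow> 0 - y \<in> chain.span (relations r)" for y
    using chain.span_add[OF assms(2), of "- y"] chain.span_diff[of "x - y" "relations r" x] assms(2) by auto
  then show ?thesis
    using assms(1) by (auto simp: B_class_def B_rel_def zero_in_chains)
qed

lemma B_class_in_B: "x \<in> chains r \<Longrightarrow> B_class r x \<in> B r"
  by (auto simp: B_def B_class_def quotient_def)

text \<open>Summing twice and halving, which is possible over the rationals, avoids choosing one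
  index from each pair.\<close>

lemma sum_in_span_if_involution:
  fixes f :: "'i \<Rightarrow> 'a \<Rightarrow>\<^sub>0 rat"
  assumes "\<And>i. i \<in> I \<Longrightarrow> s i \<in> I" "\<And>i. i \<in> I \<Longrightarrow> s (s i) = i"
    and "\<And>i. i \<in> I \<Longrightarrow> f i + f (s i) \<in> chain.span R"
  shows "sum f I \<in> chain.span R"
proof -
  have "sum f I = (\<Sum>i\<in>I. f (s i))"
    by (rule sum.reindex_bij_witness[of _ s s]) (use assms in auto)
  then have "sum f I + sum f I = (\<Sum>i\<in>I. f i + f (s i))"
    by (simp add: sum.distrib)
  also have "\<dots> \<in> chain.span R"
    using assms(3) by (rule chain.span_sum)
  finally have "qscale (1/2) (sum f I + sum f I) \<in> chain.span R"
    by (rule chain.span_scale)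
  moreover have "qscale (1/2) (sum f I + sum f I) = sum f I"
    by (auto intro!: poly_mapping_eqI simp: lookup_qscale lookup_add)
  ultimately show ?thesis by simp
qed

section \<open>Cancellation\<close>

text \<open>The graphs to be cancelled share edges, filtration and edge ordering and differ in their
  vertices and ends only, so a vertex map is all that has to be supplied and no sign arises.\<close>

lemma iso_in_relations:
  assumes "Y \<in> filtered_graphs r" "Y' \<in> filtered_graphs r"
    and "graph_iso (carrier_graph Y) (carrier_graph Y') \<phi> id" "filt Y' = filt Y" "ord Y' = ord Y"
  shows "Poly_Mapping.single Y 1 - Poly_Mapping.single Y' 1 \<in> relations r"
proof -
  have "filt Y' = map (image id) (filt Y)" "ord Y' = permute_list id (map id (ord Y))"
    using assms by simp_all
  moreover have "id permutes {..<length (ord Y)}" "of_int (sign id) = (1 :: rat)"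
    by (simp_all add: permutes_id)
  ultimately show ?thesis
    unfolding relations_def using assms(1-3) by (metis (mono_tags, lifting) mem_Collect_eq)
qed

text \<open>Collapsing \<open>F\<close> and then \<open>d\<close> forgets the difference between graphs whose edges
  have ends that differ only along \<open>insert d F\<close>.\<close>

lemma collapse_collapse_iso:
  fixes G G' :: "('v, 'e) pre_digraph"
  assumes wf: "wf_digraph G" "wf_digraph G'" and eq: "verts G' = verts G" "arcs G' = arcs G"
    and F: "F \<subseteq> arcs G" and d: "d \<in> arcs G - F"
    and near: "\<And>e. e \<in> arcs G \<Longrightarrow> joined G (insert d F) (tail G e) (tail G' e)"
      "\<And>e. e \<in> arcs G \<Longrightarrow> joined G (insert d F) (head G e) (head G' e)"
    and near': "\<And>e. e \<in> arcs G \<Longrightarrow> joined G' (insert d F) (tail G e) (tail G' e)"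
      "\<And>e. e \<in> arcs G \<Longrightarrow> joined G' (insert d F) (head G e) (head G' e)"
  shows "\<exists>\<phi>. graph_iso (collapse (collapse G F) {d}) (collapse (collapse G' F) {d}) \<phi> id"
proof -
  define c where "c G v = collapse_vertex (collapse G F) {d} (collapse_vertex G F v)" for G :: "('v, 'e) pre_digraph" and v
  have c: "c H u = c H v \<longleftrightarrow> joined H (insert d F) u v"
    if "wf_digraph H" "F \<subseteq> arcs H" "d \<in> arcs H - F" "u \<in> verts H" "v \<in> verts H" for H :: "('v, 'e) pre_digraph" and u v
  proof -
    have "wf_digraph (collapse H F)"
      using that(1) by (auto simp: wf_digraph_def verts_collapse)
    then have "c H u = c H v \<longleftrightarrow> joined (collapse H F) {d} (collapse_vertex H F u) (collapse_vertex H F v)"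
      unfolding c_def using that by (intro collapse_vertex_eq_iff) (auto simp: verts_collapse)
    then show ?thesis
      using that by (subst (asm) joined_collapse_iff) auto
  qed
  have step: "joined H' (insert d F) u v"
    if "joined H (insert d F) u v" and
      "\<And>e. e \<in> arcs G \<Longrightarrow> joined H' (insert d F) (tail H e) (tail H' e)"
      "\<And>e. e \<in> arcs G \<Longrightarrow> joined H' (insert d F) (head H e) (head H' e)" for H H' :: "('v, 'e) pre_digraph" and u v
  proof (rule joined_map[OF that(1), of H' _ "\<lambda>x. x"])
    fix e assume e: "e \<in> insert d F"
    then have "e \<in> arcs G" using d F by auto
    from that(2,3)[OF this] joined_edge[OF e, of H']
    show "joined H' (insert d F) (tail H e) (head H e)"
      by (meson joined_sym joined_trans)
  qed
  have "joined G (insert d F) u v \<longleftrightarrow> joined G' (insert d F) u v" for u v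
    using step[of G u v G'] step[of G' u v G] near near' joined_sym by metis
  then have cc: "c G u = c G v \<longleftrightarrow> c G' u = c G' v" if "u \<in> verts G" "v \<in> verts G" for u v
    using that wf F d eq by (simp add: c)
  \<comment> \<open>Both double collapses identify the same pairs of vertices, so the chosen
    preimage does not matter.\<close>
  define \<phi> where "\<phi> w = c G' (inv_into (verts G) (c G) w)" for w
  have \<phi>: "\<phi> (c G v) = c G' v" if "v \<in> verts G" for v
    using cc[of "inv_into (verts G) (c G) (c G v)" v] that
    by (simp add: \<phi>_def inv_into_into f_inv_into_f)
  have V: "verts (collapse (collapse H F) {d}) = c H ` verts H" for H :: "('v, 'e) pre_digraph"
    by (auto simp: verts_collapse c_def)
  have ends: "c G' (tail G e) = c G' (tail G' e)" "c G' (head G e) = c G' (head G' e)"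
    "tail G e \<in> verts G" "head G e \<in> verts G" if "e \<in> arcs G" for e
    using that wf eq F d near' by (auto simp: wf_digraph_def c)
  have "graph_iso (collapse (collapse G F) {d}) (collapse (collapse G' F) {d}) \<phi> id"
    unfolding graph_iso_def
  proof (intro conjI ballI)
    show "bij_betw \<phi> (verts (collapse (collapse G F) {d})) (verts (collapse (collapse G' F) {d}))"
      unfolding V eq
    proof (rule bij_betw_imageI)
      show "inj_on \<phi> (c G ` verts G)"
        using \<phi> cc by (auto simp: inj_on_def)
      show "\<phi> ` c G ` verts G = c G' ` verts G"
        unfolding image_image by (rule image_cong) (simp_all add: \<phi>)
    qed
    show "bij_betw id (arcs (collapse (collapse G F) {d})) (arcs (collapse (collapse G' F) {d}))"
      by (simp add: eq)
    fix e assume "e \<in> arcs (collapse (collapse G F) {d})"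
    then have "e \<in> arcs G" by simp
    from ends[OF this] \<phi>
    show "{tail (collapse (collapse G' F) {d}) (id e), head (collapse (collapse G' F) {d}) (id e)} =
        {\<phi> (tail (collapse (collapse G F) {d}) e), \<phi> (head (collapse (collapse G F) {d}) e)}"
      by (simp add: c_def)
  qed
  then show ?thesis by blast
qed

context AB_data
begin

section \<open>Exchanging the half-edges at the two ends of a side\<close>

definition next_corner :: "'v \<Rightarrow> nat \<Rightarrow> nat" where
  "next_corner s i = Suc i mod valence X s"

text \<open>\<open>restrict\<close> resets the values off the half-edges at \<open>s\<close> to
  \<open>undefined\<close>, as membership in \<open>attachings\<close> demands.\<close>

definition swap :: "'v \<Rightarrow> nat \<Rightarrow> ('v \<Rightarrow> 'e \<times> bool \<Rightarrow> nat) \<Rightarrow> 'v \<Rightarrow> 'e \<times> bool \<Rightarrow> nat" where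
  "swap s i \<iota> = \<iota>(s := restrict (transpose i (next_corner s i) \<circ> \<iota> s) (half_edges_at X s))"

lemma next_corner:
  assumes "s \<in> A" "i < valence X s"
  shows "next_corner s i < valence X s" "next_corner s i \<noteq> i"
  using assms valence_A_ge_3[of s] by (auto simp: next_corner_def mod_Suc)

lemma swap_in_attaching_families:
  assumes "s \<in> A" "i < valence X s" "\<iota> \<in> attaching_families"
  shows "swap s i \<iota> \<in> attaching_families"
proof -
  have "bij_betw (\<iota> s) (half_edges_at X s) {..<valence X s}"
    using assms by (auto simp: attaching_families_def attachings_def PiE_def Pi_def)
  moreover have "bij_betw (transpose i (next_corner s i)) {..<valence X s} {..<valence X s}"
    using assms next_corner by (intro permutes_imp_bij permutes_swap_id) auto
  ultimately have "bij_betw (transpose i (next_corner s i) \<circ> \<iota> s) (half_edges_at X s) {..<valence X s}"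
    by (rule bij_betw_trans)
  then have "restrict (transpose i (next_corner s i) \<circ> \<iota> s) (half_edges_at X s) \<in> attachings X s"
    unfolding attachings_def by (simp cong: bij_betw_cong)
  then show ?thesis
    using assms unfolding swap_def attaching_families_def by (auto simp: PiE_def Pi_def extensional_def)
qed

lemma swap_swap:
  assumes "s \<in> A" "\<iota> \<in> attaching_families"
  shows "swap s i (swap s i \<iota>) = \<iota>"
proof -
  have "\<iota> s \<in> extensional (half_edges_at X s)"
    using assms by (auto simp: attaching_families_def attachings_def PiE_def Pi_def)
  then show ?thesis
    by (intro ext) (simp add: swap_def extensional_def del: split_paired_All)
qed

text \<open>On the blown-up graph the exchange acts on the ends of the old edges as a transposition
  of two vertices, while the sides stay in place.\<close>

lemma attach_swap:
  assumes "s \<in> A" "e \<in> arcs X"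
  shows "attach X A (swap s i \<iota>) (e, b) =
    transpose (Corner s i) (Corner s (next_corner s i)) (attach X A \<iota> (e, b))"
proof (cases "end_of X (e, b) = s")
  case True
  then have "(e, b) \<in> half_edges_at X s"
    using assms by (simp add: half_edges_at_def del: end_of.simps)
  then show ?thesis
    using True assms by (auto simp: attach_def swap_def transpose_def simp del: end_of.simps)
next
  case False
  then show ?thesis
    by (auto simp: attach_def swap_def transpose_def simp del: end_of.simps)
qed

text \<open>Only the factor at \<open>s\<close> changes, by composition with one transposition; its
  two corners are distinct because a polygon has at least three sides.\<close>

lemma sign_swap:
  assumes h: "AB_orientation X A h" and s: "s \<in> A" "i < valence X s" and \<iota>: "\<iota> \<in> attaching_families"
  shows "(\<Prod>t \<in> A. attaching_sign (h t) (swap s i \<iota> t)) = - (\<Prod>t \<in> A. attaching_sign (h t) (\<iota> t))"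
proof -
  let ?n = "valence X s" and ?\<tau> = "transpose i (next_corner s i)"
  \<comment> \<open>The attaching map at \<open>s\<close>, turned into a permutation of numbers by
    the orientation \<open>h s\<close>.\<close>
  define p where "p k = (if k < ?n then \<iota> s (h s ! k) else k)" for k
  have hs: "distinct (h s)" "set (h s) = half_edges_at X s"
    using h s by (auto simp: AB_orientation_def)
  then have len: "length (h s) = ?n"
    by (simp add: valence_def distinct_card[symmetric])
  have "bij_betw (\<iota> s) (half_edges_at X s) {..<?n}"
    using \<iota> s by (auto simp: attaching_families_def attachings_def PiE_def Pi_def)
  moreover have "bij_betw ((!) (h s)) {..<?n} (half_edges_at X s)"
    using bij_betw_nth[OF hs(1), of "{..<?n}" "half_edges_at X s"] hs(2) len by auto
  ultimately have "bij_betw (\<iota> s \<circ> (!) (h s)) {..<?n} {..<?n}"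
    by (rule bij_betw_trans[rotated])
  then have "bij_betw p {..<?n} {..<?n}"
    by (rule bij_betw_cong[THEN iffD1, rotated]) (simp add: p_def)
  then have p: "p permutes {..<?n}"
    by (rule bij_imp_permutes) (simp add: p_def)
  have "(\<lambda>k. if k < length (h s) then swap s i \<iota> s (h s ! k) else k) = ?\<tau> \<circ> p"
  proof
    fix k
    show "(if k < length (h s) then swap s i \<iota> s (h s ! k) else k) = (?\<tau> \<circ> p) k"
    proof (cases "k < ?n")
      case True
      then have "h s ! k \<in> half_edges_at X s"
        using nth_mem[of k "h s"] hs(2) len by simp
      then show ?thesis using True by (simp add: len p_def swap_def)
    next
      case False
      then show ?thesis
        using s next_corner[OF s] by (auto simp: len p_def transpose_def)
    qed
  qed
  then have "attaching_sign (h s) (swap s i \<iota> s) = sign (?\<tau> \<circ> p)"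
    by (simp add: attaching_sign_def)
  also have "\<dots> = sign ?\<tau> * sign p"
    using p by (intro sign_compose permutation_swap_id) (auto simp: permutation_permutes)
  also have "sign ?\<tau> = - 1"
    using next_corner(2)[OF s] by (simp add: sign_swap_id)
  also have "sign p = attaching_sign (h s) (\<iota> s)"
    by (simp add: attaching_sign_def len p_def[abs_def])
  finally have "attaching_sign (h s) (swap s i \<iota> s) = - attaching_sign (h s) (\<iota> s)"
    by simp
  moreover have "(\<Prod>t \<in> A - {s}. attaching_sign (h t) (swap s i \<iota> t)) = (\<Prod>t \<in> A - {s}. attaching_sign (h t) (\<iota> t))"
    by (rule prod.cong) (auto simp: swap_def)
  ultimately show ?thesis
    using finite_A s(1) by (simp add: prod.remove)
qed

lemma arcs_swap: "arcs (blowup X A (swap s i \<iota>)) = arcs (blowup X A \<iota>)"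
  and verts_swap: "verts (blowup X A (swap s i \<iota>)) = verts (blowup X A \<iota>)"
  by (simp_all add: arcs_blowup verts_blowup)

text \<open>The one condition that depends on \<iota> is that the tree does not join the two ends of
  the side. The transposition of corners turns such a connection into its reverse for the exchanged
  attachment. The converse follows because the exchange is an involution.\<close>

lemma collapsible_swap:
  assumes s: "s \<in> A" "i < valence X s" and \<iota>: "\<iota> \<in> attaching_families"
    and coll: "collapsible (Y (swap s i \<iota>)) (Side s i)"
  shows "collapsible (Y \<iota>) (Side s i)"
proof -
  let ?F = "Old ` T" and ?\<tau> = "transpose (Corner s i) (Corner s (next_corner s i))"
  let ?G = "blowup X A \<iota>" and ?G' = "blowup X A (swap s i \<iota>)"
  interpret G: fin_digraph ?G by (rule fin_digraph_blowup[OF \<iota>])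
  interpret G': fin_digraph ?G' by (rule fin_digraph_blowup[OF swap_in_attaching_families[OF s \<iota>]])
  have corners: "Corner s i \<in> verts ?G" "Corner s (next_corner s i) \<in> verts ?G"
    using s next_corner by (auto simp: verts_blowup)
  have "\<not> joined ?G' ?F (Corner s i) (Corner s (next_corner s i))"
    using coll corners collapse_vertex_eq_iff[OF G'.wf_digraph Old_T_subset, of "Corner s i" "Corner s (next_corner s i)"]
    by (auto simp: collapsible_def verts_swap next_corner_def)
  moreover have "joined ?G' ?F (?\<tau> (Corner s i)) (?\<tau> (Corner s (next_corner s i)))"
    if "joined ?G ?F (Corner s i) (Corner s (next_corner s i))"
  proof (rule joined_map[OF that])
    fix d :: "('v, 'e) blowup_edge" assume "d \<in> ?F"
    then show "joined ?G' ?F (?\<tau> (tail ?G d)) (?\<tau> (head ?G d))"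
      using joined_edge[of d ?F ?G'] attach_swap[OF s(1)] T_subset by auto
  qed
  ultimately have "\<not> joined ?G ?F (Corner s i) (Corner s (next_corner s i))"
    using joined_sym by fastforce
  then have "tail (carrier_graph (Y \<iota>)) (Side s i) \<noteq> head (carrier_graph (Y \<iota>)) (Side s i)"
    using corners collapse_vertex_eq_iff[OF G.wf_digraph Old_T_subset, of "Corner s i" "Corner s (next_corner s i)"]
    by (auto simp: next_corner_def)
  moreover have "arcs (carrier_graph (Y (swap s i \<iota>))) = arcs (carrier_graph (Y \<iota>))"
    "filt (Y (swap s i \<iota>)) = filt (Y \<iota>)"
    by (simp_all add: arcs_swap filt_Y)
  ultimately show ?thesis
    using coll unfolding collapsible_def by auto
qed

text \<open>The exchange moves ends of old edges only from one end of the side to the other, and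
  these become one vertex when the side is collapsed.\<close>

lemma collapse_edge_swap_in_relations:
  assumes s: "s \<in> A" "i < valence X s" and \<iota>: "\<iota> \<in> attaching_families"
    and coll: "collapsible (Y \<iota>) (Side s i)" "collapsible (Y (swap s i \<iota>)) (Side s i)"
  shows "Poly_Mapping.single (collapse_edge (Y \<iota>) (Side s i)) 1
    - Poly_Mapping.single (collapse_edge (Y (swap s i \<iota>)) (Side s i)) 1 \<in> relations (length o1 + length o2)"
proof -
  let ?F = "Old ` T" and ?d = "Side s i" and ?\<tau> = "transpose (Corner s i) (Corner s (next_corner s i))"
  let ?G = "blowup X A \<iota>" and ?G' = "blowup X A (swap s i \<iota>)"
  have \<iota>': "swap s i \<iota> \<in> attaching_families"
    by (rule swap_in_attaching_families[OF s \<iota>])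
  interpret G: fin_digraph ?G by (rule fin_digraph_blowup[OF \<iota>])
  interpret G': fin_digraph ?G' by (rule fin_digraph_blowup[OF \<iota>'])
  \<comment> \<open>Stated for arbitrary \<kappa>, since ends must be compared inside both blown-up
    graphs.\<close>
  have \<tau>: "joined (blowup X A \<kappa>) (insert ?d ?F) x (?\<tau> x)" for \<kappa> x
    using joined_edge[of ?d "insert ?d ?F" "blowup X A \<kappa>"] joined_sym
    by (auto simp: transpose_def next_corner_def)
  have "joined (blowup X A \<kappa>) (insert ?d ?F) (tail ?G e) (tail ?G' e)"
    "joined (blowup X A \<kappa>) (insert ?d ?F) (head ?G e) (head ?G' e)" if "e \<in> arcs ?G" for \<kappa> e
    using that \<tau> attach_swap[OF s(1)] by (auto simp: arcs_blowup set_sides)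
  then have "\<exists>\<phi>. graph_iso (collapse (collapse ?G ?F) {?d}) (collapse (collapse ?G' ?F) {?d}) \<phi> id"
    using s by (intro collapse_collapse_iso[OF G.wf_digraph G'.wf_digraph verts_swap arcs_swap Old_T_subset])
      (auto simp: arcs_blowup set_sides)
  then obtain \<phi> where "graph_iso (collapse (collapse ?G ?F) {?d}) (collapse (collapse ?G' ?F) {?d}) \<phi> id"
    by blast
  then show ?thesis
    using collapse_edge_in_filtered_graphs[OF Y_in_filtered_graphs[OF \<iota>] coll(1)]
      collapse_edge_in_filtered_graphs[OF Y_in_filtered_graphs[OF \<iota>'] coll(2)]
    by (intro iso_in_relations) (auto simp: collapse_edge_def filt_Y ord_Y)
qed

section \<open>The boundary of \<open>Phi\<close>\<close>

lemma Phi_in_chains: "Phi X A h T o1 o2 \<in> chains (length o1 + length o2)"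
  unfolding Phi_def by (intro sum_in_chains single_in_chains Y_in_filtered_graphs) (simp add: attaching_families_def)

lemma boundary_Phi:
  "boundary (Phi X A h T o1 o2) =
    (\<Sum>\<iota>\<in>attaching_families. qscale (of_int (\<Prod>s\<in>A. attaching_sign (h s) (\<iota> s))) (dE_gen (Y \<iota>)))"
  unfolding Phi_def boundary_sum_single attaching_families_def[symmetric]
  by (rule sum.cong) (simp_all add: dF_gen_Y)

lemma boundary_Phi_in_chains: "boundary (Phi X A h T o1 o2) \<in> chains (length o1 + length o2)"
  unfolding boundary_Phi dE_gen_def
  by (intro sum_in_chains qscale_in_chains single_in_chains collapse_edge_in_filtered_graphs
      Y_in_filtered_graphs) auto

lemma boundary_Phi_in_span:
  assumes h: "AB_orientation X A h"
  shows "boundary (Phi X A h T o1 o2) \<in> chain.span (relations (length o1 + length o2))"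
proof -
  let ?L = "concat (map (sides X) o1) @ map Old o2" and ?R = "relations (length o1 + length o2)"
  define \<sigma> :: "('v \<Rightarrow> 'e \<times> bool \<Rightarrow> nat) \<Rightarrow> rat"
    where "\<sigma> \<iota> = of_int (\<Prod>s\<in>A. attaching_sign (h s) (\<iota> s))" for \<iota>
  \<comment> \<open>Padding with 0 gives all \<iota> the same range of positions. The exponent is
    \<open>(n + 1) + k - 1\<close> for filtration length \<open>k\<close>, so it too is independent
    of \<iota>, and only \<open>\<sigma>\<close> can produce the opposite sign.\<close>
  define g where "g \<iota> n = (if collapsible (Y \<iota>) (?L ! n)
    then Poly_Mapping.single (collapse_edge (Y \<iota>) (?L ! n)) ((-1) ^ (n + (length o1 + length o2)) :: rat) else 0)" for \<iota> n
  have len: "filtration_length (Y \<iota>) = length o1 + length o2" for \<iota>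
    using o2_nonempty by (simp add: filtration_length_def filt_Y)
  have "dE_gen (Y \<iota>) = (\<Sum>n<length ?L. g \<iota> n)" for \<iota>
    unfolding dE_gen_def ord_Y len g_def
    by (subst sum.inter_filter[symmetric]) (auto intro!: sum.cong)
  then have "boundary (Phi X A h T o1 o2) = (\<Sum>\<iota>\<in>attaching_families. \<Sum>n<length ?L. qscale (\<sigma> \<iota>) (g \<iota> n))"
    unfolding boundary_Phi \<sigma>_def by (simp add: chain.scale_sum_right)
  \<comment> \<open>With the position outermost, a single side is fixed in each inner sum, and the
    exchange at that side acts on all \<iota>.\<close>
  also have "\<dots> = (\<Sum>n<length ?L. \<Sum>\<iota>\<in>attaching_families. qscale (\<sigma> \<iota>) (g \<iota> n))"
    by (rule sum.swap)
  also have "\<dots> \<in> chain.span ?R"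
  proof (rule chain.span_sum)
    fix n assume "n \<in> {..<length ?L}"
    then have "?L ! n \<in> set ?L"
      by (intro nth_mem) simp
    then consider s i where "s \<in> A" "i < valence X s" "?L ! n = Side s i" | e where "?L ! n = Old e"
      using o1(2) by (auto simp: set_sides)
    then show "(\<Sum>\<iota>\<in>attaching_families. qscale (\<sigma> \<iota>) (g \<iota> n)) \<in> chain.span ?R"
    proof cases
      case (1 s i)
      show ?thesis
      proof (rule sum_in_span_if_involution[where s = "swap s i"])
        fix \<iota> assume \<iota>: "\<iota> \<in> attaching_families"
        show \<iota>': "swap s i \<iota> \<in> attaching_families"
          by (rule swap_in_attaching_families[OF 1(1,2) \<iota>])
        show ss: "swap s i (swap s i \<iota>) = \<iota>"
          by (rule swap_swap[OF 1(1) \<iota>])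
        have coll: "collapsible (Y (swap s i \<iota>)) (Side s i) \<longleftrightarrow> collapsible (Y \<iota>) (Side s i)"
          using collapsible_swap[OF 1(1,2) \<iota>] collapsible_swap[OF 1(1,2) \<iota>'] by (auto simp: ss)
        have \<sigma>: "\<sigma> (swap s i \<iota>) = - \<sigma> \<iota>"
          unfolding \<sigma>_def sign_swap[OF h 1(1,2) \<iota>] by simp
        show "qscale (\<sigma> \<iota>) (g \<iota> n) + qscale (\<sigma> (swap s i \<iota>)) (g (swap s i \<iota>) n) \<in> chain.span ?R"
        proof (cases "collapsible (Y \<iota>) (Side s i)")
          case True
          let ?a = "\<sigma> \<iota> * (-1) ^ (n + (length o1 + length o2))"
          have "qscale (\<sigma> \<iota>) (g \<iota> n) + qscale (\<sigma> (swap s i \<iota>)) (g (swap s i \<iota>) n) =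
              qscale ?a (Poly_Mapping.single (collapse_edge (Y \<iota>) (Side s i)) 1
                - Poly_Mapping.single (collapse_edge (Y (swap s i \<iota>)) (Side s i)) 1)"
            using True coll
            by (simp add: g_def 1(3) \<sigma> qscale_single chain.scale_right_diff_distrib single_uminus)
          moreover have "\<dots> \<in> chain.span ?R"
            using collapse_edge_swap_in_relations[OF 1(1,2) \<iota> True] True coll
            by (intro chain.span_scale chain.span_base) simp
          ultimately show ?thesis by simp
        next
          case False
          then show ?thesis
            using coll by (simp add: g_def 1(3) chain.span_zero)
        qed
      qed
    next
      case (2 e)
      then show ?thesis
        by (simp add: g_def not_collapsible_Old chain.span_zero)
    qed
  qed
  finally show ?thesis .
qed

end

theorem proposition7p4:
  fixes X :: "('v, 'e) pre_digraph" and A :: "'v set" and h :: "'v \<Rightarrow> ('e \<times> bool) list"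
    and T :: "'e set" and o1 :: "'v list" and o2 :: "'e list" and r :: nat
  assumes "odd_AB_graph X A" and "AB_orientation X A h"
    and "maximal_tree X T"
    and "distinct o1" and "set o1 = A"
    and "distinct o2" and "set o2 = arcs X - T"
    and "r = length o1 + length o2"
  shows "B_class r (Phi X A h T o1 o2) \<in> B r \<and>
    B_class r (boundary (Phi X A h T o1 o2)) = B_class r 0"
proof -
  interpret AB_data X A T o1 o2
    using assms by unfold_locales (simp_all add: odd_AB_graph_def)
  show ?thesis
    using B_class_in_B[OF Phi_in_chains]
      B_class_eq_zero[OF boundary_Phi_in_chains boundary_Phi_in_span[OF assms(2)]] assms(8) by simp
qed

end
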